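(* There are absolute constants $C,c>0$ such that the following hold for the Propp machine on $\mathbb{Z}$. (i) For every integer $L\ge 2$, every even initial configuration, every time $t\in\mathbb{N}_0$ and every interval $X\subseteq\mathbb{Z}$ of length $L$, $$|f(X,t)-E(X,t)|\le C\log L .$$ (ii) For every integer $L>0$ there are an even initial configuration, a time $t\in\mathbb{N}_0$ and an interval $X\subseteq\mathbb{Z}$ of length $L$ such that $$|f(X,t)-E(X,t)|\ge c\log L .$$
   Context: $\mathbb{N}_0$ is the set of non-negative integers. An interval of length $L$ in $\mathbb{Z}$ is a set of $L$ consecutive integers. Propp machine on $\mathbb{Z}$: at each time $t\in\mathbb{N}_0$, each vertex $x\in\mathbb{Z}$ holds a number $f(x,t)\in\mathbb{N}_0$ of chips and an arrow $\mathrm{ARR}(x,t)\in\{-1,+1\}$ ($+1$ = right, $-1$ = left). The initial configuration (the values $f(x,0)$ and $\mathrm{ARR}(x,0)$, $x\in\mathbb{Z}$; infinitely many vertices may hold chips) determines all later configurations by $$f(x,t+1)=\tfrac12 f(x-1,t)+\tfrac12 f(x+1,t)+\tfrac12\mathrm{ARR}(x-1,t)\,(f(x-1,t)\bmod 2)-\tfrac12\mathrm{ARR}(x+1,t)\,(f(x+1,t)\bmod 2),$$ $$\mathrm{ARR}(x,t+1)=(-1)^{f(x,t)}\,\mathrm{ARR}(x,t).$$ A configuration is even if no chip is at an odd position (arrows are unrestricted). $E(x,t)$ is the expected number of chips at $x$ after all chips of the initial configuration perform independent simple random walks for $t$ steps, i.e. $E(x,t)=\sum_{y\in\mathbb{Z}}f(y,0)\,H(x-y,t)$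 (a finite sum), where $H(z,t)=2^{-t}\binom{t}{(t+z)/2}$ if $t-z$ is even (which is $0$ if $|z|>t$) and $H(z,t)=0$ otherwise. For finite $X\subseteq\mathbb{Z}$, $f(X,t):=\sum_{x\in X}f(x,t)$ and $E(X,t):=\sum_{x\in X}E(x,t)$. *)

theory Defs
  imports "HOL-Analysis.Analysis"
begin

text \<open>A configuration consists of the chip counts and the arrows (\<open>1\<close> = right, \<open>-1\<close> = left).\<close>

type_synonym config = "(int \<Rightarrow> nat) \<times> (int \<Rightarrow> int)"

definition is_config :: "config \<Rightarrow> bool" where
  "is_config c \<longleftrightarrow> (\<forall>x. snd c x \<in> {-1, 1})"

definition even_config :: "config \<Rightarrow> bool" where
  "even_config c \<longleftrightarrow> is_config c \<and> (\<forall>x. odd x \<longrightarrow> fst c x = 0)"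

text \<open>
  If the arrows are \<open>\<plusminus>1\<close>, the numerator in the first component is even and non-negative, so
  \<open>div\<close> and \<open>nat\<close> lose nothing; see \<open>chips_Suc\<close> below for the update rule with real halves.
\<close>

definition propp_step :: "config \<Rightarrow> config" where
  "propp_step c = (case c of (f, A) \<Rightarrow>
     (\<lambda>x. nat ((int (f (x - 1)) + int (f (x + 1))
                + A (x - 1) * int (f (x - 1) mod 2)
                - A (x + 1) * int (f (x + 1) mod 2)) div 2),
      \<lambda>x. (-1) ^ f x * A x))"

definition chips :: "config \<Rightarrow> int \<Rightarrow> nat \<Rightarrow> nat" where
  "chips c x t = fst ((propp_step ^^ t) c) x"

definition arr :: "config \<Rightarrow> int \<Rightarrow> nat \<Rightarrow> int" where
  "arr c x t = snd ((propp_step ^^ t) c) x"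

definition walk_prob :: "int \<Rightarrow> nat \<Rightarrow> real" where
  "walk_prob z t =
     (if even (int t - z) \<and> \<bar>z\<bar> \<le> int t
      then real (t choose nat ((int t + z) div 2)) / 2 ^ t else 0)"

text \<open>Only finitely many terms are nonzero; see \<open>expected_chips_finite\<close> below.\<close>

definition expected_chips :: "config \<Rightarrow> int \<Rightarrow> nat \<Rightarrow> real" where
  "expected_chips c x t = (\<Sum>\<^sub>\<infinity>y\<in>UNIV. real (chips c y 0) * walk_prob (x - y) t)"

definition interval_of_length :: "int set \<Rightarrow> nat \<Rightarrow> bool" where
  "interval_of_length X L \<longleftrightarrow> (\<exists>a. X = {a..<a + int L})"

definition discrepancy :: "config \<Rightarrow> int set \<Rightarrow> nat \<Rightarrow> real" where
  "discrepancy c X t = \<bar>real (\<Sum>x\<in>X. chips c x t) - (\<Sum>x\<in>X. expected_chips c x t)\<bar>"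

lemma chips_0 [simp]: "chips c x 0 = fst c x"
  by (simp add: chips_def)

lemma arr_0 [simp]: "arr c x 0 = snd c x"
  by (simp add: arr_def)

lemma arr_Suc: "arr c x (Suc t) = (-1) ^ chips c x t * arr c x t"
  by (simp add: arr_def chips_def propp_step_def case_prod_beta)

lemma arr_cases:
  assumes "is_config c"
  shows "arr c x t = -1 \<or> arr c x t = 1"
proof (induction t)
  case 0
  then show ?case using assms by (auto simp: is_config_def)
next
  case (Suc t)
  then show ?case
    by (cases "even (chips c x t)") (auto simp: arr_Suc)
qed

lemma chips_Suc:
  assumes "is_config c"
  shows "real (chips c x (Suc t)) =
    1/2 * real (chips c (x - 1) t) + 1/2 * real (chips c (x + 1) t)
    + 1/2 * real_of_int (arr c (x - 1) t) * real (chips c (x - 1) t mod 2)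
    - 1/2 * real_of_int (arr c (x + 1) t) * real (chips c (x + 1) t mod 2)"
proof -
  define m where "m = chips c (x - 1) t"
  define n where "n = chips c (x + 1) t"
  define A where "A = arr c (x - 1) t"
  define B where "B = arr c (x + 1) t"
  define N where "N = int m + int n + A * int (m mod 2) - B * int (n mod 2)"
  have "A = -1 \<or> A = 1" "B = -1 \<or> B = 1"
    using arr_cases[OF assms] by (auto simp: A_def B_def)
  moreover have "int m \<ge> int (m mod 2)" "int n \<ge> int (n mod 2)"
    by (simp_all only: of_nat_le_iff mod_less_eq_dividend)
  moreover have "even (int m + int (m mod 2))" "even (int n + int (n mod 2))"
    by presburger+
  ultimately have "N \<ge> 0" "even N"
    unfolding N_def by auto
  moreover have "chips c x (Suc t) = nat (N div 2)"
    by (simp add: chips_def arr_def propp_step_def case_prod_beta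
        N_def m_def n_def A_def B_def)
  ultimately have "2 * int (chips c x (Suc t)) = N"
    by simp
  then have "real_of_int (2 * int (chips c x (Suc t))) = real_of_int N"
    by (rule arg_cong)
  then show ?thesis
    unfolding N_def m_def [symmetric] n_def [symmetric] A_def [symmetric] B_def [symmetric]
    by (simp add: field_simps)
qed

lemma expected_chips_finite:
  "expected_chips c x t =
     (\<Sum>y\<in>{x - int t..x + int t}. real (chips c y 0) * walk_prob (x - y) t)"
proof -
  have "expected_chips c x t =
      (\<Sum>\<^sub>\<infinity>y\<in>{x - int t..x + int t}. real (chips c y 0) * walk_prob (x - y) t)"
    unfolding expected_chips_def
    by (rule infsum_cong_neutral) (auto simp: walk_prob_def)
  then show ?thesis by simp
qed

end

theory Submission
  imports Defs
begin

text \<open>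
  Let \<open>H\<close> denote the transition probabilities of simple random walk. An even pile splits exactly like the
  expected random walk, so the machine deviates from the walk only through leftover chips of odd piles.
  Replacing the machine by the walk one step at a time gives an exact formula (\<open>interval_discrepancy\<close>): the
  deviation on an interval is the sum over all positions \<open>y\<close> and times \<open>s\<close> of the signed leftover chip at
  \<open>(y, s)\<close> times its influence. On an interval the influences telescope to half the difference
  \<open>H(P - y, u) - H(Q - y, u)\<close> of walk probabilities at the two endpoints, where \<open>u\<close> is the remaining time.

  For the upper bound, fix \<open>y\<close>. Its arrow turns exactly when a chip is left over, so the signs of these chips
  alternate and the contribution of \<open>y\<close> is at most the total variation of the influence as a function of time
  (\<open>alternating_sum_le_variation\<close>). The function \<open>H(p, u)\<close> is unimodal in \<open>u\<close> with peak of order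
  \<open>1 / p\<close>; this bounds the contribution of a position at distance \<open>p\<close> from an endpoint by a multiple of
  \<open>1 / p\<close> (\<open>column_deviation_near\<close>), which suffices for the positions within distance about \<open>L\<close> and yields
  \<open>ln L\<close>. For farther positions the two endpoints must cancel: by the ballot identity
  \<open>H(p, u) - H(p + 2, u)\<close> is twice a first-passage probability, which is again unimodal in \<open>u\<close> with peak of
  order \<open>1 / p^2\<close>. Summing about \<open>L / 2\<close> of these bounds the contribution by a multiple of \<open>L / p^2\<close>
  (\<open>column_deviation_far_left\<close>, \<open>column_deviation_far_right\<close>), and these sum to a constant.

  For the lower bound, the parities of all piles can be prescribed for any finite time span
  (\<open>parity_forcing\<close>): adding multiples of \<open>2 ^ T\<close> chips changes nothing about parities before time \<open>T\<close> and
  allows any correction at time \<open>T\<close>. Hence there is a configuration in which each position at even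
  distance \<open>d = 2 * j\<close> to the left of the first point of the interval, up to about \<open>sqrt L\<close>, has a single leftover chip, with arrow
  to the right, at remaining time \<open>d^2\<close>. There its influence is at least a constant times \<open>1 / (d + 1)\<close>
  (\<open>walk_prob_sqrt_ge\<close>), no chip feels the far endpoint, and the contributions add up to order \<open>ln L\<close>.
\<close>

section \<open>The deviation as a sum over leftover chips\<close>

lemma walk_prob_0: "walk_prob z 0 = (if z = 0 then 1 else 0)"
  by (auto simp: walk_prob_def)

lemma walk_prob_eq_0: "int u < \<bar>z\<bar> \<or> odd (int u + z) \<Longrightarrow> walk_prob z u = 0"
  by (auto simp: walk_prob_def)

lemma walk_prob_binomial: "walk_prob (2 * int k - int u) u = real (u choose k) / 2 ^ u"
proof (cases "k \<le> u")
  case True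
  then show ?thesis by (auto simp: walk_prob_def)
qed (auto simp: walk_prob_def)

lemma walk_prob_minus: "walk_prob (- z) u = walk_prob z u"
proof (cases "even (int u + z) \<and> \<bar>z\<bar> \<le> int u")
  case True
  define k where "k = nat ((int u + z) div 2)"
  have z: "z = 2 * int k - int u" and k: "k \<le> u" using True unfolding k_def by auto
  have "- z = 2 * int (u - k) - int u" using z k by auto
  then have "walk_prob (- z) u = real (u choose (u - k)) / 2 ^ u"
    by (simp only: walk_prob_binomial)
  moreover have "walk_prob z u = real (u choose k) / 2 ^ u"
    by (simp only: z walk_prob_binomial)
  ultimately show ?thesis using binomial_symmetric[OF k] by simp
next
  case False
  then have "walk_prob z u = 0" "walk_prob (- z) u = 0" by (auto simp: walk_prob_def)
  then show ?thesis by simp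
qed

lemma walk_prob_Suc: "walk_prob z (Suc u) = (walk_prob (z - 1) u + walk_prob (z + 1) u) / 2"
proof (cases "even (int (Suc u) + z) \<and> \<bar>z\<bar> \<le> int (Suc u)")
  case True
  define k where "k = nat ((int (Suc u) + z) div 2)"
  have z: "z = 2 * int k - int (Suc u)" using True unfolding k_def by auto
  have "z + 1 = 2 * int k - int u" using z by simp
  then have r: "walk_prob (z + 1) u = real (u choose k) / 2 ^ u"
    by (simp only: walk_prob_binomial)
  show ?thesis
  proof (cases k)
    case 0
    then show ?thesis using z r walk_prob_binomial[of 0 "Suc u"] walk_prob_eq_0[of u "z - 1"]
      by simp
  next
    case (Suc k')
    have "z - 1 = 2 * int k' - int u" using z Suc by simp
    then have "walk_prob (z - 1) u = real (u choose k') / 2 ^ u"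
      by (simp only: walk_prob_binomial)
    moreover have "walk_prob z (Suc u) = real (Suc u choose k) / 2 ^ Suc u"
      by (simp only: z walk_prob_binomial)
    ultimately show ?thesis unfolding r using Suc by (simp add: add_divide_distrib)
  qed
next
  case False
  then have "int (Suc u) < \<bar>z\<bar> \<or> odd (int (Suc u) + z)" by linarith
  then have "int u < \<bar>z - 1\<bar> \<or> odd (int u + (z - 1))" "int u < \<bar>z + 1\<bar> \<or> odd (int u + (z + 1))"
    by auto
  with \<open>int (Suc u) < \<bar>z\<bar> \<or> odd (int (Suc u) + z)\<close> show ?thesis
    by (simp add: walk_prob_eq_0)
qed

text \<open>
  The signed number of unpaired chips at \<open>y\<close>: an even number of chips splits exactly as the
  random walk does on average, so only the sign of a leftover chip causes a deviation.
\<close>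

definition imbalance :: "config \<Rightarrow> int \<Rightarrow> nat \<Rightarrow> real" where
  "imbalance c y s = of_int (arr c y s) * real (chips c y s mod 2)"

text \<open>
  Replacing the machine by the random walk one time step at a time, the error made at time \<open>s\<close> is
  carried by the leftover chips: such a chip moves to \<open>y + 1\<close> or \<open>y - 1\<close> instead of to half of each,
  and this shift is then propagated by the walk for the remaining \<open>t - 1 - s\<close> steps. Both sides satisfy the
  same recursion in \<open>t\<close>. The sums range over an arbitrary window \<open>W\<close> containing the light cone of
  \<open>x\<close>, so that the induction can use one window for all positions.
\<close>

lemma chips_expansion:
  assumes "is_config c" and "finite W" and "{x - int t..x + int t} \<subseteq> W"
  shows "real (chips c x t) = (\<Sum>y\<in>W. real (chips c y 0) * walk_prob (x - y) t)
    + (\<Sum>s<t. \<Sum>y\<in>W. imbalance c y s *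
        ((walk_prob (x - y - 1) (t - 1 - s) - walk_prob (x - y + 1) (t - 1 - s)) / 2))"
  using assms(3)
proof (induction t arbitrary: x)
  case 0
  then have "x \<in> W" by auto
  have "(\<Sum>y\<in>W. real (chips c y 0) * walk_prob (x - y) 0) =
      (\<Sum>y\<in>W. if x = y then real (chips c y 0) else 0)"
    by (intro sum.cong) (auto simp: walk_prob_0)
  with \<open>x \<in> W\<close> show ?case by (simp add: assms(2))
next
  case (Suc t)
  define I where "I x y u = (walk_prob (x - y - 1) u - walk_prob (x - y + 1) u) / 2" for x y u
  define D where "D x t = (\<Sum>s<t. \<Sum>y\<in>W. imbalance c y s * I x y (t - 1 - s))" for x t
  define E where "E x t = (\<Sum>y\<in>W. real (chips c y 0) * walk_prob (x - y) t)" for x t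
  have W: "x - 1 \<in> W" "x + 1 \<in> W" using Suc.prems by auto
  have IH: "real (chips c (x - 1) t) = E (x - 1) t + D (x - 1) t"
    "real (chips c (x + 1) t) = E (x + 1) t + D (x + 1) t"
    unfolding E_def D_def I_def using Suc.prems by (intro Suc.IH; auto)+
  have x: "x - y - 1 = x - 1 - y" "x - y + 1 = x + 1 - y" for x y :: int by simp_all
  have E: "E x (Suc t) = (E (x - 1) t + E (x + 1) t) / 2"
    unfolding E_def walk_prob_Suc sum.distrib [symmetric] sum_divide_distrib x
    by (simp add: distrib_left)
  have I: "I x y (Suc u) = (I (x - 1) y u + I (x + 1) y u) / 2" for y u
  proof -
    have arg: "x - y - 1 - 1 = x - 1 - y - 1" "x - y - 1 + 1 = x - y"
      "x - y + 1 - 1 = x - y" "x - y + 1 + 1 = x + 1 - y + 1"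
      "x - 1 - y + 1 = x - y" "x + 1 - y - 1 = x - y" by simp_all
    show ?thesis unfolding I_def walk_prob_Suc arg by argo
  qed
  have "imbalance c y s * I x y (Suc t - 1 - s) =
      (imbalance c y s * I (x - 1) y (t - 1 - s) + imbalance c y s * I (x + 1) y (t - 1 - s)) / 2"
    if "s < t" for s y
  proof -
    have u: "Suc t - 1 - s = Suc (t - 1 - s)" using that by simp
    show ?thesis unfolding u I by (simp add: distrib_left)
  qed
  then have "(\<Sum>s<t. \<Sum>y\<in>W. imbalance c y s * I x y (Suc t - 1 - s)) =
      (D (x - 1) t + D (x + 1) t) / 2"
    unfolding D_def sum.distrib [symmetric] sum_divide_distrib by (intro sum.cong refl) simp
  moreover have "(\<Sum>y\<in>W. imbalance c y t * I x y 0) =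
      (\<Sum>y\<in>W. (if y = x - 1 then imbalance c y t / 2 else 0)
        - (if y = x + 1 then imbalance c y t / 2 else 0))"
    by (intro sum.cong) (auto simp: walk_prob_0 I_def)
  moreover have "\<dots> = (imbalance c (x - 1) t - imbalance c (x + 1) t) / 2"
    using W assms(2) by (simp add: sum_subtractf diff_divide_distrib)
  moreover have "D x (Suc t) = (\<Sum>s<t. \<Sum>y\<in>W. imbalance c y s * I x y (Suc t - 1 - s))
      + (\<Sum>y\<in>W. imbalance c y t * I x y 0)"
    by (simp add: D_def)
  ultimately have "D x (Suc t) = (D (x - 1) t + D (x + 1) t) / 2
      + (imbalance c (x - 1) t - imbalance c (x + 1) t) / 2"
    by linarith
  then have "real (chips c x (Suc t)) = E x (Suc t) + D x (Suc t)"
    unfolding chips_Suc[OF assms(1)] E IH by (simp add: imbalance_def field_simps)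
  then show ?case by (simp only: E_def D_def I_def)
qed

lemma telescope_two_step:
  fixes F :: "int \<Rightarrow> real"
  shows "(\<Sum>x\<in>{a..<a + int L}. F (x - 1) - F (x + 1)) =
    F (a - 1) + F a - F (a + int L - 1) - F (a + int L)"
proof (induction L)
  case (Suc L)
  have "{a..<a + int (Suc L)} = insert (a + int L) {a..<a + int L}" by auto
  with Suc show ?case by (simp add: algebra_simps)
qed simp

text \<open>
  Over an interval the influences \<open>H(x - y - 1, u) - H(x - y + 1, u)\<close> telescope, and only
  the walk probabilities at its two ends survive.
\<close>

lemma interval_discrepancy:
  assumes "is_config c"
  shows "(\<Sum>x\<in>{a..<a + int L}. real (chips c x t)) - (\<Sum>x\<in>{a..<a + int L}. expected_chips c x t) =
    (\<Sum>y\<in>{a - int t..a + int L + int t}. \<Sum>s<t. imbalance c y s *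
      ((walk_prob (a - 1 - y) (t - 1 - s) + walk_prob (a - y) (t - 1 - s)
        - walk_prob (a + int L - 1 - y) (t - 1 - s) - walk_prob (a + int L - y) (t - 1 - s)) / 2))"
proof -
  let ?X = "{a..<a + int L}" and ?W = "{a - int t..a + int L + int t}"
  let ?I = "\<lambda>x y u. (walk_prob (x - y - 1) u - walk_prob (x - y + 1) u) / 2"
  have E: "expected_chips c x t = (\<Sum>y\<in>?W. real (chips c y 0) * walk_prob (x - y) t)"
    if "x \<in> ?X" for x
    unfolding expected_chips_finite using that
    by (intro sum.mono_neutral_left) (auto simp: walk_prob_def)
  have "real (chips c x t) - expected_chips c x t =
      (\<Sum>s<t. \<Sum>y\<in>?W. imbalance c y s * ?I x y (t - 1 - s))" if "x \<in> ?X" for x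
    using chips_expansion[OF assms, of ?W x t] E[OF that] that by auto
  then have "(\<Sum>x\<in>?X. real (chips c x t)) - (\<Sum>x\<in>?X. expected_chips c x t) =
      (\<Sum>x\<in>?X. \<Sum>s<t. \<Sum>y\<in>?W. imbalance c y s * ?I x y (t - 1 - s))"
    by (simp add: sum_subtractf [symmetric])
  also have "\<dots> = (\<Sum>s<t. \<Sum>x\<in>?X. \<Sum>y\<in>?W. imbalance c y s * ?I x y (t - 1 - s))"
    by (rule sum.swap)
  also have "\<dots> = (\<Sum>s<t. \<Sum>y\<in>?W. \<Sum>x\<in>?X. imbalance c y s * ?I x y (t - 1 - s))"
    by (intro sum.cong refl sum.swap)
  also have "\<dots> = (\<Sum>y\<in>?W. \<Sum>s<t. \<Sum>x\<in>?X. imbalance c y s * ?I x y (t - 1 - s))"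
    by (rule sum.swap)
  also have "\<dots> = (\<Sum>y\<in>?W. \<Sum>s<t. imbalance c y s *
      ((walk_prob (a - 1 - y) (t - 1 - s) + walk_prob (a - y) (t - 1 - s)
        - walk_prob (a + int L - 1 - y) (t - 1 - s) - walk_prob (a + int L - y) (t - 1 - s)) / 2))"
  proof (intro sum.cong refl)
    fix y :: int and s :: nat
    let ?u = "t - 1 - s"
    have shift: "x - y - 1 = x - 1 - y" "x - y + 1 = x + 1 - y" for x by simp_all
    have "(\<Sum>x\<in>?X. walk_prob (x - y - 1) ?u - walk_prob (x - y + 1) ?u) =
      walk_prob (a - 1 - y) ?u + walk_prob (a - y) ?u
        - walk_prob (a + int L - 1 - y) ?u - walk_prob (a + int L - y) ?u"
      using telescope_two_step[of "\<lambda>x. walk_prob (x - y) ?u" a L] by (simp only: shift)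
    then show "(\<Sum>x\<in>?X. imbalance c y s * ?I x y ?u) = imbalance c y s *
      ((walk_prob (a - 1 - y) ?u + walk_prob (a - y) ?u
        - walk_prob (a + int L - 1 - y) ?u - walk_prob (a + int L - y) ?u) / 2)"
      unfolding sum_distrib_left [symmetric] sum_divide_distrib [symmetric] by simp
  qed
  finally show ?thesis .
qed

section \<open>Alternating sums and total variation\<close>

text \<open>
  Total variation on \<open>0, ..., n\<close> of the sequence that starts from the value \<open>0\<close>
  before time \<open>0\<close>.
\<close>

definition variation :: "(nat \<Rightarrow> real) \<Rightarrow> nat \<Rightarrow> real" where
  "variation h n = \<bar>h 0\<bar> + (\<Sum>u<n. \<bar>h (Suc u) - h u\<bar>)"

lemma abs_le_variation: "\<bar>h n\<bar> \<le> variation h n"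
  by (induction n) (auto simp: variation_def)

lemma variation_sum_le: "variation (\<lambda>u. \<Sum>i\<in>A. h i u) n \<le> (\<Sum>i\<in>A. variation (h i) n)"
proof -
  have "(\<Sum>u<n. \<bar>(\<Sum>i\<in>A. h i (Suc u)) - (\<Sum>i\<in>A. h i u)\<bar>) \<le> (\<Sum>u<n. \<Sum>i\<in>A. \<bar>h i (Suc u) - h i u\<bar>)"
    by (intro sum_mono) (simp add: sum_subtractf [symmetric])
  also have "\<dots> = (\<Sum>i\<in>A. \<Sum>u<n. \<bar>h i (Suc u) - h i u\<bar>)" by (rule sum.swap)
  finally show ?thesis
    unfolding variation_def sum.distrib by (intro add_mono sum_abs)
qed

lemma variation_diff_le:
  "variation (\<lambda>u. (g u - h u) / 2) n \<le> (variation g n + variation h n) / 2"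
proof -
  have "(\<Sum>u<n. \<bar>(g (Suc u) - h (Suc u)) / 2 - (g u - h u) / 2\<bar>)
      \<le> (\<Sum>u<n. (\<bar>g (Suc u) - g u\<bar> + \<bar>h (Suc u) - h u\<bar>) / 2)"
    by (intro sum_mono) (auto simp: abs_if field_simps)
  also have "\<dots> = ((\<Sum>u<n. \<bar>g (Suc u) - g u\<bar>) + (\<Sum>u<n. \<bar>h (Suc u) - h u\<bar>)) / 2"
    by (simp add: sum.distrib sum_divide_distrib [symmetric])
  moreover have "\<bar>(g 0 - h 0) / 2\<bar> \<le> (\<bar>g 0\<bar> + \<bar>h 0\<bar>) / 2" by argo
  ultimately show ?thesis
    using add_mono by (fastforce simp: variation_def add_divide_distrib)
qed

text \<open>
  Up to the peak \<open>m\<close> the variation of \<open>h\<close> is its current value; after the peak it is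
  \<open>2 * h m - h n\<close>.
\<close>

lemma variation_unimodal_le:
  assumes "\<And>u. 0 \<le> h u" and "\<And>u. u < m \<Longrightarrow> h u \<le> h (Suc u)" and "\<And>u. m \<le> u \<Longrightarrow> h (Suc u) \<le> h u"
  shows "variation h n \<le> 2 * h m"
proof -
  have "variation h n = (if n \<le> m then h n else 2 * h m - h n)"
  proof (induction n)
    case 0
    then show ?case using assms(1)[of 0] by (simp add: variation_def)
  next
    case (Suc n)
    have s: "variation h (Suc n) = variation h n + \<bar>h (Suc n) - h n\<bar>" by (simp add: variation_def)
    show ?case
    proof (cases "n < m")
      case True
      then show ?thesis using Suc assms(2)[of n] by (simp add: s)
    next
      case False
      then show ?thesis using Suc assms(3)[of n] unfolding s by (cases "n = m") auto
    qed
  qed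
  moreover have "h n \<le> h m" if "n \<le> m"
    using that by (induction rule: inc_induct) (auto intro: order_trans assms(2))
  ultimately show ?thesis using assms(1)[of n] assms(1)[of m] by auto
qed

text \<open>
  The walk kernels at distance \<open>w\<close> live on the times \<open>w, w + 2, w + 4, ...\<close>. Holding each value
  for one more step makes them sequences on all times without changing their variation, while the parity of
  even configurations guarantees that the filled-in values are never read.
\<close>

definition stretch :: "nat \<Rightarrow> (nat \<Rightarrow> real) \<Rightarrow> nat \<Rightarrow> real" where
  "stretch w h u = (if u < w then 0 else h ((u - w) div 2))"

lemma variation_stretch_le:
  assumes "\<And>k. 0 \<le> h k" and "\<And>k. k < m \<Longrightarrow> h k \<le> h (Suc k)" and "\<And>k. m \<le> k \<Longrightarrow> h (Suc k) \<le> h k"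
  shows "variation (stretch w h) n \<le> 2 * h m"
proof -
  have div: "(Suc u - w) div 2 = (u - w) div 2 \<or> (Suc u - w) div 2 = Suc ((u - w) div 2)"
    if "w \<le> u" for u
    using that by (auto simp: Suc_diff_le)
  have "variation (stretch w h) n \<le> 2 * stretch w h (w + 2 * m)"
  proof (rule variation_unimodal_le)
    show "0 \<le> stretch w h u" for u using assms(1) by (simp add: stretch_def)
    show "stretch w h u \<le> stretch w h (Suc u)" if "u < w + 2 * m" for u
    proof (cases "w \<le> u")
      case True
      then have "(u - w) div 2 < m" using that by auto
      then show ?thesis using div[OF True] assms(2) True by (auto simp: stretch_def)
    qed (simp add: stretch_def assms(1))
    show "stretch w h (Suc u) \<le> stretch w h u" if "w + 2 * m \<le> u" for u
    proof -
      have "w \<le> u" "m \<le> (u - w) div 2" using that by auto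
      then show ?thesis using div[of u] assms(3) by (auto simp: stretch_def)
    qed
  qed
  then show ?thesis by (simp add: stretch_def)
qed

lemma abel_summation:
  fixes \<tau> h :: "nat \<Rightarrow> real"
  shows "(\<Sum>u<n. (\<tau> (Suc u) - \<tau> u) * h u) =
    \<tau> n * h n - \<tau> 0 * h 0 - (\<Sum>u<n. \<tau> (Suc u) * (h (Suc u) - h u))"
  by (induction n) (auto simp: algebra_simps)

lemma imbalance_eq:
  assumes "is_config c"
  shows "imbalance c y s = (of_int (arr c y s) - of_int (arr c y (Suc s))) / 2"
proof (cases "even (chips c y s)")
  case False
  then have "chips c y s mod 2 = 1" by presburger
  then show ?thesis using False by (simp add: imbalance_def arr_Suc)
qed (simp add: imbalance_def arr_Suc)

text \<open>
  At a fixed position the rotor turns exactly when a chip is left over, so the signs of the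
  consecutive leftover chips alternate. Quantitatively, the imbalance is half a difference of consecutive
  arrows, and summation by parts moves the difference to \<open>h\<close>.
\<close>

lemma alternating_sum_le_variation:
  assumes "is_config c"
  shows "\<bar>\<Sum>s<t. imbalance c y s * h (t - 1 - s)\<bar> \<le> variation h t"
proof -
  \<comment> \<open>The arrow seen backwards from the final time, so that \<open>h\<close> is read forwards.\<close>
  define \<tau> :: "nat \<Rightarrow> real" where "\<tau> u = of_int (arr c y (t - u))" for u
  have \<tau>: "\<bar>\<tau> u\<bar> = 1" for u
    using arr_cases[OF assms, of y "t - u"] by (auto simp: \<tau>_def)
  have "(\<Sum>s<t. imbalance c y s * h (t - 1 - s)) = (\<Sum>u<t. imbalance c y (t - 1 - u) * h u)"
    by (subst sum.nat_diff_reindex [symmetric]) (auto intro!: sum.cong)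
  also have "\<dots> = (\<Sum>u<t. (\<tau> (Suc u) - \<tau> u) * h u) / 2"
    unfolding sum_divide_distrib
  proof (intro sum.cong refl)
    fix u assume "u \<in> {..<t}"
    then have "Suc (t - 1 - u) = t - u" "t - 1 - u = t - Suc u" by auto
    then show "imbalance c y (t - 1 - u) * h u = (\<tau> (Suc u) - \<tau> u) * h u / 2"
      unfolding imbalance_eq[OF assms] by (simp add: \<tau>_def)
  qed
  finally have e: "(\<Sum>s<t. imbalance c y s * h (t - 1 - s)) =
    (\<tau> t * h t - \<tau> 0 * h 0 - (\<Sum>u<t. \<tau> (Suc u) * (h (Suc u) - h u))) / 2"
    by (simp add: abel_summation)
  have "\<bar>\<Sum>u<t. \<tau> (Suc u) * (h (Suc u) - h u)\<bar> \<le> (\<Sum>u<t. \<bar>\<tau> (Suc u) * (h (Suc u) - h u)\<bar>)"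
    by (rule sum_abs)
  also have "\<dots> = (\<Sum>u<t. \<bar>h (Suc u) - h u\<bar>)" by (simp add: abs_mult \<tau>)
  finally have "\<bar>\<Sum>u<t. \<tau> (Suc u) * (h (Suc u) - h u)\<bar> \<le> (\<Sum>u<t. \<bar>h (Suc u) - h u\<bar>)" .
  moreover have "\<bar>\<tau> t * h t\<bar> = \<bar>h t\<bar>" "\<bar>\<tau> 0 * h 0\<bar> = \<bar>h 0\<bar>" by (simp_all add: abs_mult \<tau>)
  moreover have "\<bar>h t\<bar> \<le> \<bar>h 0\<bar> + (\<Sum>u<t. \<bar>h (Suc u) - h u\<bar>)"
    using abs_le_variation[of h t] by (simp add: variation_def)
  moreover have "\<bar>(a - b - c) / 2\<bar> \<le> p + q"
    if "\<bar>c\<bar> \<le> q" "\<bar>a\<bar> = r" "\<bar>b\<bar> = p" "r \<le> p + q" for a b c p q r :: real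
  proof -
    have "- r \<le> a" "a \<le> r" "- p \<le> b" "b \<le> p" "- q \<le> c" "c \<le> q" using that by auto
    then show ?thesis using that(4) unfolding abs_le_iff by argo
  qed
  ultimately show ?thesis unfolding e variation_def by blast
qed

section \<open>Walk and first-passage probabilities as functions of time\<close>

text \<open>
  The probability that the simple random walk is at distance \<open>z\<close> to the right at time
  \<open>z + 2 * k\<close>.
\<close>

definition walk_density :: "nat \<Rightarrow> nat \<Rightarrow> real" where
  "walk_density z k = real ((z + 2 * k) choose k) / 2 ^ (z + 2 * k)"

text \<open>
  By the ballot theorem, for \<open>w > 0\<close> this is the probability that the walk first reaches \<open>w\<close> at
  time \<open>w + 2 * k\<close>.
\<close>

definition passage :: "nat \<Rightarrow> nat \<Rightarrow> real" where
  "passage w k = real w / real (w + 2 * k) * walk_density w k"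

lemma walk_density_nonneg: "0 \<le> walk_density z k"
  by (simp add: walk_density_def)

lemma passage_nonneg: "0 \<le> passage w k"
  by (simp add: passage_def walk_density_nonneg)

lemma Suc_times_binomial_Suc: "Suc k * (n choose Suc k) = (n - k) * (n choose k)"
proof (cases n)
  case (Suc m)
  then show ?thesis
    using Suc_times_binomial[of k m] binomial_absorb_comp[of n k] by (simp del: binomial_Suc_Suc)
qed simp

lemma walk_prob_eq_stretch:
  assumes "even (int u + z)"
  shows "walk_prob z u = stretch (nat \<bar>z\<bar>) (walk_density (nat \<bar>z\<bar>)) u"
proof -
  define n where "n = nat \<bar>z\<bar>"
  have "z = int n \<or> z = - int n" unfolding n_def by auto
  then have z: "walk_prob z u = walk_prob (int n) u" by (auto simp: walk_prob_minus)
  show ?thesis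
  proof (cases "u < n")
    case True
    then show ?thesis unfolding z n_def [symmetric] by (simp add: stretch_def walk_prob_def)
  next
    case False
    have "even (u - n)" using False assms \<open>z = int n \<or> z = - int n\<close> by auto
    then obtain k where k: "u - n = 2 * k" by (elim evenE)
    then have u: "u = n + 2 * k" using False by simp
    have "int n = 2 * int (n + k) - int u" unfolding u by simp
    then have "walk_prob (int n) u = real (u choose (n + k)) / 2 ^ u"
      by (simp only: walk_prob_binomial)
    also have "u choose (n + k) = u choose k"
      using binomial_symmetric[of k u] u by (simp add: add.commute)
    finally show ?thesis
      unfolding z n_def [symmetric] by (simp add: stretch_def u walk_density_def)
  qed
qed

text \<open>
  The ratio of consecutive terms is rational, so unimodality reduces to comparing two
  quadratics whose difference is \<open>z^2 - z - 2 * k - 2\<close>: the probability of being at \<open>z\<close> peaks at time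
  \<open>z^2\<close>.
\<close>

lemma walk_density_Suc:
  "4 * (real k + 1) * (real z + real k + 1) * walk_density z (Suc k) =
    (real z + 2 * real k + 2) * (real z + 2 * real k + 1) * walk_density z k"
proof -
  define n where "n = z + 2 * k"
  have "Suc k * (Suc (Suc n) choose Suc k) = Suc (Suc n) * (Suc n choose k)"
    by (rule Suc_times_binomial)
  then have "real (Suc k) * real (Suc (Suc n) choose Suc k) = real (Suc (Suc n)) * real (Suc n choose k)"
    by (simp only: of_nat_mult [symmetric])
  then have 1: "(real k + 1) * real (Suc (Suc n) choose Suc k) = (real n + 2) * real (Suc n choose k)"
    by (simp add: add.commute del: binomial_Suc_Suc)
  have "(Suc n - k) * (Suc n choose k) = Suc n * (n choose k)"
    using binomial_absorb_comp[of "Suc n" k] by simp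
  moreover have "Suc n - k = z + k + 1" by (simp add: n_def)
  ultimately have "real ((z + k + 1) * (Suc n choose k)) = real (Suc n * (n choose k))" by simp
  then have 2: "(real z + real k + 1) * real (Suc n choose k) = (real n + 1) * real (n choose k)"
    unfolding of_nat_mult by (simp add: add.commute)
  have w: "walk_density z k = real (n choose k) / 2 ^ n"
    "walk_density z (Suc k) = real (Suc (Suc n) choose Suc k) / (4 * 2 ^ n)"
    by (simp_all add: walk_density_def n_def)
  have "4 * (real k + 1) * (real z + real k + 1) * walk_density z (Suc k) =
    (real z + real k + 1) * ((real k + 1) * real (Suc (Suc n) choose Suc k)) / 2 ^ n"
    unfolding w by (simp add: field_simps del: binomial_Suc_Suc)
  also have "\<dots> = (real n + 2) * ((real z + real k + 1) * real (Suc n choose k)) / 2 ^ n"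
    unfolding 1 by simp
  also have "\<dots> = (real n + 2) * (real n + 1) * walk_density z k" unfolding 2 w by simp
  finally show ?thesis by (simp add: n_def)
qed

lemma mult_eq_imp_le:
  fixes a b p q :: real
  assumes "a * p = b * q" "0 < a" "0 \<le> q"
  shows "a \<le> b \<Longrightarrow> q \<le> p" "b \<le> a \<Longrightarrow> p \<le> q"
proof -
  show "q \<le> p" if "a \<le> b"
  proof -
    have "a * q \<le> a * p" using assms that by (simp add: mult_right_mono)
    then show ?thesis using assms(2) by simp
  qed
  show "p \<le> q" if "b \<le> a"
  proof -
    have "a * p \<le> a * q" using assms that by (simp add: mult_right_mono)
    then show ?thesis using assms(2) by simp
  qed
qed

lemma walk_density_unimodal:
  shows "k < (z * z - z) div 2 \<Longrightarrow> walk_density z k \<le> walk_density z (Suc k)"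
    and "(z * z - z) div 2 \<le> k \<Longrightarrow> walk_density z (Suc k) \<le> walk_density z k"
proof -
  have e: "(real z + 2 * real k + 2) * (real z + 2 * real k + 1) -
      4 * (real k + 1) * (real z + real k + 1) = real (z * z) - real (z + 2 * k + 2)"
    by (simp add: algebra_simps)
  have pos: "0 < 4 * (real k + 1) * (real z + real k + 1)" by (simp add: add_nonneg_pos)
  have "even (z * z - z)" by simp
  then have c: "k < (z * z - z) div 2 \<longleftrightarrow> z + 2 * k + 2 \<le> z * z" by (auto elim!: evenE)
  show "walk_density z k \<le> walk_density z (Suc k)" if "k < (z * z - z) div 2"
  proof -
    have "z + 2 * k + 2 \<le> z * z" using that c by simp
    then have "real (z + 2 * k + 2) \<le> real (z * z)" by (simp only: of_nat_le_iff)
    then show ?thesis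
      using mult_eq_imp_le(1)[OF walk_density_Suc[of k z] pos walk_density_nonneg] e by linarith
  qed
  show "walk_density z (Suc k) \<le> walk_density z k" if "(z * z - z) div 2 \<le> k"
  proof -
    have "z * z \<le> z + 2 * k + 2" using that c by linarith
    then have "real (z * z) \<le> real (z + 2 * k + 2)" by (simp only: of_nat_le_iff)
    then show ?thesis
      using mult_eq_imp_le(2)[OF walk_density_Suc[of k z] pos walk_density_nonneg] e by linarith
  qed
qed

lemma passage_Suc:
  assumes "0 < w"
  shows "4 * (real k + 1) * (real w + real k + 1) * passage w (Suc k) =
    (real w + 2 * real k + 1) * (real w + 2 * real k) * passage w k"
proof -
  define v where "v = real w + 2 * real k"
  have v: "0 < v" "real (w + 2 * k) = v" "real (w + 2 * Suc k) = v + 2" using assms by (simp_all add: v_def)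
  have "4 * (real k + 1) * (real w + real k + 1) * passage w (Suc k) =
    real w / (v + 2) * (4 * (real k + 1) * (real w + real k + 1) * walk_density w (Suc k))"
    unfolding passage_def v by simp
  also have "\<dots> = real w / (v + 2) * ((v + 2) * (v + 1) * walk_density w k)"
    unfolding walk_density_Suc v_def by simp
  also have "\<dots> = (v + 1) * v * (real w / v * walk_density w k)"
    using v(1) by simp
  finally show ?thesis unfolding passage_def v by (simp add: v_def)
qed

text \<open>
  The difference of the two quadratics in the recursion is \<open>w^2 - 3 * w - 6 * k - 4\<close>, so
  the first-passage probability at \<open>w\<close> peaks at a time close to \<open>w^2 / 3\<close>.
\<close>

lemma passage_unimodal:
  assumes "0 < w"
  shows "k < (w * w + 2 - 3 * w) div 6 \<Longrightarrow> passage w k \<le> passage w (Suc k)"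
    and "(w * w + 2 - 3 * w) div 6 \<le> k \<Longrightarrow> passage w (Suc k) \<le> passage w k"
proof -
  have e: "(real w + 2 * real k + 1) * (real w + 2 * real k) -
      4 * (real k + 1) * (real w + real k + 1) = real (w * w) - real (3 * w + 6 * k + 4)"
    by (simp add: algebra_simps)
  have pos: "0 < 4 * (real k + 1) * (real w + real k + 1)" by (simp add: add_nonneg_pos)
  have c: "k < (w * w + 2 - 3 * w) div 6 \<longleftrightarrow> 3 * w + 6 * k + 4 \<le> w * w"
    by (cases "3 * w \<le> w * w + 2") (auto simp: less_eq_Suc_le[of k] less_eq_div_iff_mult_less_eq)
  show "passage w k \<le> passage w (Suc k)" if "k < (w * w + 2 - 3 * w) div 6"
  proof -
    have "3 * w + 6 * k + 4 \<le> w * w" using that c by simp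
    then have "real (3 * w + 6 * k + 4) \<le> real (w * w)" by (simp only: of_nat_le_iff)
    then show ?thesis
      using mult_eq_imp_le(1)[OF passage_Suc[OF assms, of k] pos passage_nonneg] e by linarith
  qed
  show "passage w (Suc k) \<le> passage w k" if "(w * w + 2 - 3 * w) div 6 \<le> k"
  proof -
    have "w * w \<le> 3 * w + 6 * k + 4" using that c by linarith
    then have "real (w * w) \<le> real (3 * w + 6 * k + 4)" by (simp only: of_nat_le_iff)
    then show ?thesis
      using mult_eq_imp_le(2)[OF passage_Suc[OF assms, of k] pos passage_nonneg] e by linarith
  qed
qed

text \<open>
  The central binomial probability decreases by the factor
  \<open>(2 * n + 1) / (2 * n + 2)\<close>, whose square lies between \<open>(4 * n + 1) / (4 * n + 5)\<close> and
  \<open>(2 * n + 1) / (2 * n + 3)\<close>; hence its square is of order \<open>1 / n\<close>.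
\<close>

lemma central_density_bounds:
  "(walk_density 0 n)\<^sup>2 * (2 * real n + 1) \<le> 1" "1 \<le> (walk_density 0 n)\<^sup>2 * (4 * real n + 1)"
proof -
  have rec: "2 * (real n + 1) * walk_density 0 (Suc n) = (2 * real n + 1) * walk_density 0 n" for n
  proof -
    have "(2 * (real n + 1)) * (2 * (real n + 1) * walk_density 0 (Suc n)) =
        (2 * (real n + 1)) * ((2 * real n + 1) * walk_density 0 n)"
      using walk_density_Suc[of n 0] by (simp add: algebra_simps)
    moreover have "0 < 2 * (real n + 1)" by (simp add: add_nonneg_pos)
    ultimately show ?thesis by simp
  qed
  have sq: "(walk_density 0 (Suc n))\<^sup>2 = (2 * real n + 1)\<^sup>2 / (2 * (real n + 1))\<^sup>2 * (walk_density 0 n)\<^sup>2" for n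
  proof -
    have "walk_density 0 (Suc n) = (2 * real n + 1) / (2 * (real n + 1)) * walk_density 0 n"
      using rec[of n] by (simp add: field_simps)
    then show ?thesis by (simp only: power_mult_distrib power_divide)
  qed
  show "(walk_density 0 n)\<^sup>2 * (2 * real n + 1) \<le> 1"
  proof (induction n)
    case (Suc n)
    have "(2 * real n + 1)\<^sup>2 / (2 * (real n + 1))\<^sup>2 * (2 * real (Suc n) + 1) \<le> 2 * real n + 1"
      by (simp add: divide_simps) (simp add: power2_eq_square algebra_simps)
    then have "(2 * real n + 1)\<^sup>2 / (2 * (real n + 1))\<^sup>2 * (2 * real (Suc n) + 1) * (walk_density 0 n)\<^sup>2
        \<le> (2 * real n + 1) * (walk_density 0 n)\<^sup>2" by (intro mult_right_mono) auto
    also have "\<dots> \<le> 1" using Suc by (simp only: mult.commute)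
    finally show ?case unfolding sq by (simp only: mult.commute mult.left_commute)
  qed (simp add: walk_density_def)
  show "1 \<le> (walk_density 0 n)\<^sup>2 * (4 * real n + 1)"
  proof (induction n)
    case (Suc n)
    have step: "4 * real n + 1 \<le> (2 * real n + 1)\<^sup>2 / (2 * (real n + 1))\<^sup>2 * (4 * real (Suc n) + 1)"
      by (simp add: divide_simps) (simp add: power2_eq_square algebra_simps)
    have "1 \<le> (4 * real n + 1) * (walk_density 0 n)\<^sup>2" using Suc by (simp only: mult.commute)
    also have "\<dots> \<le> (2 * real n + 1)\<^sup>2 / (2 * (real n + 1))\<^sup>2 * (4 * real (Suc n) + 1) * (walk_density 0 n)\<^sup>2"
      using step by (intro mult_right_mono) auto
    finally show ?case unfolding sq by (simp only: mult.commute mult.left_commute)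
  qed (simp add: walk_density_def)
qed

lemma binomial_density_sq_le: "(real (u choose k) / 2 ^ u)\<^sup>2 * (real u + 1) \<le> 1"
proof -
  have "real (u choose k) / 2 ^ u \<le> real (u choose (u div 2)) / 2 ^ u"
    by (intro divide_right_mono) (auto simp: binomial_maximum)
  then have "(real (u choose k) / 2 ^ u)\<^sup>2 \<le> (real (u choose (u div 2)) / 2 ^ u)\<^sup>2"
    by (intro power_mono) auto
  then have "(real (u choose k) / 2 ^ u)\<^sup>2 * (real u + 1)
      \<le> (real (u choose (u div 2)) / 2 ^ u)\<^sup>2 * (real u + 1)"
    by (intro mult_right_mono) auto
  also have "\<dots> \<le> 1"
  proof (cases "even u")
    case True
    then obtain n where u: "u = 2 * n" by (elim evenE)
    then show ?thesis using central_density_bounds(1)[of n] by (simp add: walk_density_def)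
  next
    case False
    then obtain n where u: "u = 2 * n + 1" by (elim oddE)
    have "Suc (2 * n) choose Suc n = Suc (2 * n) choose n"
      using binomial_symmetric[of n "Suc (2 * n)"] by simp
    then have "real (u choose (u div 2)) / 2 ^ u = walk_density 0 (Suc n)"
      by (simp add: u walk_density_def)
    then have "(real (u choose (u div 2)) / 2 ^ u)\<^sup>2 * (real u + 1)
        \<le> (walk_density 0 (Suc n))\<^sup>2 * (2 * real (Suc n) + 1)"
      by (simp add: u mult_left_mono)
    also have "\<dots> \<le> 1" by (rule central_density_bounds)
    finally show ?thesis .
  qed
  finally show ?thesis .
qed

lemma walk_density_peak_le: "walk_density z ((z * z - z) div 2) \<le> 2 / (real z + 1)"
proof -
  define m where "m = (z * z - z) div 2"
  have "even (z * z - z)" "z \<le> z * z" by (simp_all add: le_square)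
  then have m: "z + 2 * m = z * z" unfolding m_def by simp
  have "(walk_density z m)\<^sup>2 * (real (z * z) + 1) \<le> 1"
    using binomial_density_sq_le[of "z * z" m] unfolding walk_density_def m by simp
  then have "(walk_density z m)\<^sup>2 \<le> 1 / (real (z * z) + 1)" by (simp add: field_simps add_pos_nonneg)
  also have "\<dots> \<le> (2 / (real z + 1))\<^sup>2"
  proof -
    have "0 \<le> (real z - 1)\<^sup>2 + 2 * (real z)\<^sup>2 + 2" by simp
    then have "2 * real z \<le> 3 + 3 * (real z * real z)" by (simp add: power2_eq_square algebra_simps)
    moreover have "0 < real (z * z) + 1" "0 < real z + 1" by (simp_all add: add_nonneg_pos)
    ultimately show ?thesis
      by (simp add: divide_simps power2_eq_square) (simp add: algebra_simps)
  qed
  finally have "walk_density z m \<le> 2 / (real z + 1)" by (rule power2_le_imp_le) simp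
  then show ?thesis by (simp add: m_def)
qed

text \<open>
  At the peak the time \<open>v\<close> is at least \<open>w^2 / 4\<close>, and there the two factors of the
  first-passage probability are at most \<open>w / v\<close> and \<open>1 / sqrt v\<close>.
\<close>

lemma passage_peak_le:
  assumes "0 < w"
  shows "passage w ((w * w + 2 - 3 * w) div 6) \<le> 8 / (real w)\<^sup>2"
proof -
  define m where "m = (w * w + 2 - 3 * w) div 6"
  define v where "v = w + 2 * m"
  have "w * w + 2 - 3 * w < 6 * m + 6" unfolding m_def by presburger
  then have 3: "w * w \<le> 3 * v + 3" unfolding v_def by simp
  have v: "w * w \<le> 4 * v"
  proof (cases "3 \<le> v")
    case False
    then have "w \<le> 2" by (simp add: v_def)
    then have "w * w \<le> 4 * w" by (intro mult_right_mono) auto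
    also have "\<dots> \<le> 4 * v" by (simp add: v_def)
    finally show ?thesis .
  qed (use 3 in simp)
  have v0: "0 < real v" using assms by (simp add: v_def)
  have "(walk_density w m)\<^sup>2 * (real v + 1) \<le> 1"
    using binomial_density_sq_le[of v m] unfolding walk_density_def v_def by simp
  then have "(walk_density w m)\<^sup>2 * real v \<le> 1" by (simp add: distrib_left) (smt (verit) zero_le_power2)
  then have "(walk_density w m)\<^sup>2 \<le> 1 / real v" using v0 by (simp add: field_simps)
  then have "(passage w m)\<^sup>2 \<le> (real w / real v)\<^sup>2 * (1 / real v)"
    unfolding passage_def v_def [symmetric] power_mult_distrib by (intro mult_left_mono) auto
  also have "\<dots> = real w ^ 2 / real v ^ 3" by (simp add: power2_eq_square power3_eq_cube)
  also have "\<dots> \<le> real w ^ 2 / ((real w)\<^sup>2 / 4) ^ 3"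
  proof (intro divide_left_mono power_mono)
    have "real (w * w) \<le> real (4 * v)" using v by (simp only: of_nat_le_iff)
    then show "(real w)\<^sup>2 / 4 \<le> real v" by (simp add: power2_eq_square)
  qed (use assms v0 in auto)
  also have "\<dots> = (8 / (real w)\<^sup>2)\<^sup>2"
    using assms by (simp add: field_simps power2_eq_square power3_eq_cube)
  finally have "passage w m \<le> 8 / (real w)\<^sup>2" by (rule power2_le_imp_le) simp
  then show ?thesis by (simp add: m_def)
qed

lemma variation_walk_le: "variation (stretch z (walk_density z)) n \<le> 4 / (real z + 1)"
  using variation_stretch_le[of "walk_density z" "(z * z - z) div 2" z n]
    walk_density_nonneg[of z] walk_density_unimodal[where z = z] walk_density_peak_le[of z]
  by fastforce

lemma variation_passage_le:
  assumes "0 < w"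
  shows "variation (stretch v (passage w)) n \<le> 16 / (real w)\<^sup>2"
  using variation_stretch_le[of "passage w" "(w * w + 2 - 3 * w) div 6" v n]
    passage_nonneg[of w] passage_unimodal[OF assms] passage_peak_le[OF assms]
  by fastforce

text \<open>
  Ballot identity: half the drop of the walk probability from \<open>z\<close> to \<open>z + 2\<close>
  at time \<open>u\<close> is the probability that the walk first reaches \<open>z + 1\<close> at time \<open>u + 1\<close>. This makes
  differences of walk probabilities sums of unimodal sequences.
\<close>

lemma walk_prob_diff_eq_passage:
  assumes "even (int u + int z)"
  shows "(walk_prob (int z) u - walk_prob (int (z + 2)) u) / 2 = stretch z (passage (z + 1)) u"
proof (cases "u < z")
  case True
  then show ?thesis by (simp add: stretch_def walk_prob_def)
next
  case False
  have "even (u - z)" using False assms by auto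
  then obtain k where "u - z = 2 * k" by (elim evenE)
  then have u: "u = z + 2 * k" using False by simp
  have 1: "walk_prob (int z) u = real (u choose k) / 2 ^ u"
    using walk_prob_eq_stretch[of u "int z"] assms by (simp add: stretch_def u walk_density_def)
  have 2: "walk_prob (int (z + 2)) u = stretch (z + 2) (walk_density (z + 2)) u"
    using walk_prob_eq_stretch[of u "int (z + 2)"] assms by (simp add: nat_add_distrib)
  have p: "stretch z (passage (z + 1)) u = (real z + 1) / (real u + 1) * (real (Suc u choose k) / (2 * 2 ^ u))"
    by (simp add: stretch_def u passage_def walk_density_def add.commute add.left_commute)
  show ?thesis
  proof (cases k)
    case 0
    then show ?thesis unfolding 1 2 p by (simp add: u stretch_def)
  next
    case (Suc j)
    have "k * (u choose k) = (z + k + 1) * (u choose j)"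
      using Suc_times_binomial_Suc[of j u] u Suc by simp
    then have "real (k * (u choose k)) = real ((z + k + 1) * (u choose j))" by simp
    then have e: "real k * real (u choose k) = (real z + real k + 1) * real (u choose j)"
      unfolding of_nat_mult by simp
    have "walk_prob (int (z + 2)) u = real (u choose j) / 2 ^ u"
      unfolding 2 by (simp add: stretch_def u Suc walk_density_def)
    moreover have "real (Suc u choose k) = real (u choose k) + real (u choose j)"
      using Suc by simp
    moreover have "(real u + 1) * (real (u choose k) - real (u choose j)) =
        (real z + 1) * (real (u choose k) + real (u choose j))"
      using e by (simp add: u algebra_simps)
    then have "real (u choose k) - real (u choose j) =
        (real z + 1) / (real u + 1) * (real (u choose k) + real (u choose j))"
      by (simp add: field_simps)
    ultimately show ?thesis unfolding 1 p by (simp add: diff_divide_distrib [symmetric])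
  qed
qed

section \<open>The upper bound\<close>

lemma chips_eq_0_of_odd:
  assumes "even_config c"
  shows "odd (x + int t) \<Longrightarrow> chips c x t = 0"
proof (induction t arbitrary: x)
  case 0
  then show ?case using assms by (simp add: even_config_def)
next
  case (Suc t)
  have "chips c (x - 1) t = 0" "chips c (x + 1) t = 0" using Suc by auto
  then have "real (chips c x (Suc t)) = 0"
    using assms by (subst chips_Suc) (auto simp: even_config_def)
  then show ?case by simp
qed

lemma imbalance_eq_0_of_odd:
  assumes "even_config c" and "odd (y + int s)"
  shows "imbalance c y s = 0"
  using chips_eq_0_of_odd[OF assms] by (simp add: imbalance_def)

text \<open>
  A test sequence may be changed at times of the wrong parity, since in an even
  configuration position \<open>y\<close> is empty at those times.
\<close>

lemma column_deviation_sum_le_variation: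
  assumes "even_config c"
    and "\<And>u. u < t \<Longrightarrow> even (y + int (t - 1 - u)) \<Longrightarrow> g u = h u"
  shows "\<bar>\<Sum>s<t. imbalance c y s * g (t - 1 - s)\<bar> \<le> variation h t"
proof -
  have "imbalance c y s * g (t - 1 - s) = imbalance c y s * h (t - 1 - s)" if "s < t" for s
  proof (cases "even (y + int s)")
    case True
    have "t - 1 - (t - 1 - s) = s" using that by simp
    then show ?thesis using assms(2)[of "t - 1 - s"] that True by simp
  qed (simp add: imbalance_eq_0_of_odd[OF assms(1)])
  then have "(\<Sum>s<t. imbalance c y s * g (t - 1 - s)) = (\<Sum>s<t. imbalance c y s * h (t - 1 - s))"
    by (intro sum.cong) auto
  then show ?thesis
    using alternating_sum_le_variation[of c y h t] assms(1) by (simp add: even_config_def)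
qed

text \<open>
  The contribution of position \<open>y\<close> to the deviation on an interval, where \<open>P\<close> and \<open>Q\<close> are
  the positions at its left and right end that a walk from \<open>y\<close> can occupy at the times in question.
\<close>

definition column_deviation :: "config \<Rightarrow> nat \<Rightarrow> int \<Rightarrow> int \<Rightarrow> int \<Rightarrow> real" where
  "column_deviation c t P Q y =
     (\<Sum>s<t. imbalance c y s * ((walk_prob (P - y) (t - 1 - s) - walk_prob (Q - y) (t - 1 - s)) / 2))"

text \<open>
  Close to the interval the two endpoints are treated separately, at the cost of one peak value
  of the walk kernel each.
\<close>

lemma column_deviation_near:
  assumes "even_config c" "odd (P + int t)" "odd (Q + int t)"
  shows "\<bar>column_deviation c t P Q y\<bar> \<le> 2 / (\<bar>real_of_int (P - y)\<bar> + 1) + 2 / (\<bar>real_of_int (Q - y)\<bar> + 1)"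
proof -
  define p where "p = nat \<bar>P - y\<bar>"
  define q where "q = nat \<bar>Q - y\<bar>"
  let ?h = "\<lambda>u. (stretch p (walk_density p) u - stretch q (walk_density q) u) / 2"
  have "\<bar>column_deviation c t P Q y\<bar> \<le> variation ?h t"
    unfolding column_deviation_def
  proof (rule column_deviation_sum_le_variation[OF assms(1)])
    fix u assume u: "u < t" "even (y + int (t - 1 - u))"
    have "int (t - 1 - u) = int t - 1 - int u" using u(1) by simp
    then have "even (int u + (P - y))" "even (int u + (Q - y))" using u(2) assms(2,3) by auto
    then show "(walk_prob (P - y) u - walk_prob (Q - y) u) / 2 = ?h u"
      by (simp add: walk_prob_eq_stretch p_def q_def)
  qed
  also have "\<dots> \<le> (variation (stretch p (walk_density p)) t + variation (stretch q (walk_density q)) t) / 2"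
    by (rule variation_diff_le)
  also have "\<dots> \<le> (4 / (real p + 1) + 4 / (real q + 1)) / 2"
    by (intro divide_right_mono add_mono variation_walk_le) simp
  also have "\<dots> = 2 / (\<bar>real_of_int (P - y)\<bar> + 1) + 2 / (\<bar>real_of_int (Q - y)\<bar> + 1)"
  proof -
    have "(4 / v + 4 / w) / 2 = 2 / v + 2 / w" for v w :: real by (simp add: add_divide_distrib)
    then show ?thesis by (simp add: p_def q_def)
  qed
  finally show ?thesis .
qed

lemma walk_prob_diff_telescope:
  assumes "even (int u + int p)"
  shows "(walk_prob (int p) u - walk_prob (int (p + 2 * m)) u) / 2 =
    (\<Sum>i<m. stretch (p + 2 * i) (passage (p + 2 * i + 1)) u)"
proof (induction m)
  case (Suc m)
  have "(walk_prob (int (p + 2 * m)) u - walk_prob (int (p + 2 * m + 2)) u) / 2 =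
      stretch (p + 2 * m) (passage (p + 2 * m + 1)) u"
    using assms by (intro walk_prob_diff_eq_passage) simp
  then show ?case using Suc by (simp add: diff_divide_distrib add.assoc)
qed simp

text \<open>
  The cancellation that makes distant positions harmless: the kernels of the two
  endpoints differ by \<open>m\<close> first-passage sequences, each of variation of order \<open>1 / p^2\<close>.
\<close>

lemma variation_passage_sum_le:
  assumes "0 < p"
  shows "variation (\<lambda>u. \<Sum>i<m. stretch (p + 2 * i) (passage (p + 2 * i + 1)) u) t \<le> 16 * real m / (real p)\<^sup>2"
proof -
  have "variation (\<lambda>u. \<Sum>i<m. stretch (p + 2 * i) (passage (p + 2 * i + 1)) u) t
      \<le> (\<Sum>i<m. variation (stretch (p + 2 * i) (passage (p + 2 * i + 1))) t)"
    by (rule variation_sum_le)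
  also have "\<dots> \<le> (\<Sum>i<m. 16 / (real p)\<^sup>2)"
  proof (rule sum_mono)
    fix i
    have "variation (stretch (p + 2 * i) (passage (p + 2 * i + 1))) t \<le> 16 / (real (p + 2 * i + 1))\<^sup>2"
      by (rule variation_passage_le) simp
    also have "\<dots> \<le> 16 / (real p)\<^sup>2"
      using assms by (intro divide_left_mono power_mono) auto
    finally show "variation (stretch (p + 2 * i) (passage (p + 2 * i + 1))) t \<le> 16 / (real p)\<^sup>2" .
  qed
  finally show ?thesis by (simp add: mult.commute)
qed

lemma column_deviation_far_left:
  assumes "even_config c" "odd (P + int t)" "odd (Q + int t)" "y < P" "P \<le> Q"
  shows "\<bar>column_deviation c t P Q y\<bar> \<le> 8 * real_of_int (Q - P) / (real_of_int (P - y))\<^sup>2"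
proof -
  define p where "p = nat (P - y)"
  define m where "m = nat ((Q - P) div 2)"
  have p: "P - y = int p" "0 < p" using assms(4) by (simp_all add: p_def)
  have "even (Q - P)" using assms(2,3) by auto
  then have m: "Q - P = 2 * int m" using assms(5) by (simp add: m_def)
  have q: "Q - y = int (p + 2 * m)" using p(1) m by simp
  have "\<bar>column_deviation c t P Q y\<bar> \<le> variation (\<lambda>u. \<Sum>i<m. stretch (p + 2 * i) (passage (p + 2 * i + 1)) u) t"
    unfolding column_deviation_def p(1) q
  proof (rule column_deviation_sum_le_variation[OF assms(1)])
    fix u assume u: "u < t" "even (y + int (t - 1 - u))"
    have "int (t - 1 - u) = int t - 1 - int u" using u(1) by simp
    then have "even (int u + (P - y))" using u(2) assms(2) by auto
    then have "even (int u + int p)" by (simp only: p(1))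
    then show "(walk_prob (int p) u - walk_prob (int (p + 2 * m)) u) / 2 =
        (\<Sum>i<m. stretch (p + 2 * i) (passage (p + 2 * i + 1)) u)"
      by (rule walk_prob_diff_telescope)
  qed
  also have "\<dots> \<le> 16 * real m / (real p)\<^sup>2" by (rule variation_passage_sum_le[OF p(2)])
  also have "\<dots> = 8 * real_of_int (Q - P) / (real_of_int (P - y))\<^sup>2" unfolding m p(1) by simp
  finally show ?thesis .
qed

lemma column_deviation_far_right:
  assumes "even_config c" "odd (P + int t)" "odd (Q + int t)" "Q < y" "P \<le> Q"
  shows "\<bar>column_deviation c t P Q y\<bar> \<le> 8 * real_of_int (Q - P) / (real_of_int (y - Q))\<^sup>2"
proof -
  define p where "p = nat (y - Q)"
  define m where "m = nat ((Q - P) div 2)"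
  have p: "y - Q = int p" "0 < p" using assms(4) by (simp_all add: p_def)
  have "even (Q - P)" using assms(2,3) by auto
  then have m: "Q - P = 2 * int m" using assms(5) by (simp add: m_def)
  have q: "y - P = int (p + 2 * m)" using p(1) m by simp
  have flip: "walk_prob (Q - y) u = walk_prob (int p) u"
    "walk_prob (P - y) u = walk_prob (int (p + 2 * m)) u" for u
    using walk_prob_minus[of "Q - y" u] walk_prob_minus[of "P - y" u] by (simp_all only: minus_diff_eq p(1) q)
  have "column_deviation c t P Q y =
      - (\<Sum>s<t. imbalance c y s * ((walk_prob (int p) (t - 1 - s) - walk_prob (int (p + 2 * m)) (t - 1 - s)) / 2))"
    unfolding column_deviation_def flip sum_negf [symmetric]
    by (intro sum.cong refl) (simp add: algebra_simps diff_divide_distrib)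
  then have "\<bar>column_deviation c t P Q y\<bar> =
      \<bar>\<Sum>s<t. imbalance c y s * ((walk_prob (int p) (t - 1 - s) - walk_prob (int (p + 2 * m)) (t - 1 - s)) / 2)\<bar>"
    by (simp only: abs_minus_cancel)
  also have "\<dots> \<le> variation (\<lambda>u. \<Sum>i<m. stretch (p + 2 * i) (passage (p + 2 * i + 1)) u) t"
  proof (rule column_deviation_sum_le_variation[OF assms(1)])
    fix u assume u: "u < t" "even (y + int (t - 1 - u))"
    have "int (t - 1 - u) = int t - 1 - int u" using u(1) by simp
    then have "even (int u + (y - Q))" using u(2) assms(3) by auto
    then have "even (int u + int p)" by (simp only: p(1))
    then show "(walk_prob (int p) u - walk_prob (int (p + 2 * m)) u) / 2 =
        (\<Sum>i<m. stretch (p + 2 * i) (passage (p + 2 * i + 1)) u)"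
      by (rule walk_prob_diff_telescope)
  qed
  also have "\<dots> \<le> 16 * real m / (real p)\<^sup>2" by (rule variation_passage_sum_le[OF p(2)])
  also have "\<dots> = 8 * real_of_int (Q - P) / (real_of_int (y - Q))\<^sup>2" unfolding m p(1) by simp
  finally show ?thesis .
qed

lemma sum_inverse_dist_le:
  "(\<Sum>z\<in>{- int N..int N}. 1 / (\<bar>real_of_int z\<bar> + 1)) \<le> 2 * (1 + ln (real N + 1))"
proof (induction N)
  case (Suc N)
  have "{- int (Suc N)..int (Suc N)} = insert (- int (Suc N)) (insert (int (Suc N)) {- int N..int N})"
    by auto
  then have "(\<Sum>z\<in>{- int (Suc N)..int (Suc N)}. 1 / (\<bar>real_of_int z\<bar> + 1)) =
      2 / (real N + 2) + (\<Sum>z\<in>{- int N..int N}. 1 / (\<bar>real_of_int z\<bar> + 1))"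
    by simp
  moreover have "1 / (real N + 2) \<le> ln (real N + 2) - ln (real N + 1)"
  proof -
    have "ln ((real N + 1) / (real N + 2)) \<le> (real N + 1) / (real N + 2) - 1"
      by (intro ln_le_minus_one) simp
    moreover have "(real N + 1) / (real N + 2) - 1 = - (1 / (real N + 2))" by (simp add: field_simps)
    ultimately show ?thesis by (simp add: ln_div)
  qed
  moreover have "2 / (real N + 2) = 2 * (1 / (real N + 2))" by simp
  moreover have "ln (real (Suc N) + 1) = ln (real N + 2)" by (simp add: add.commute)
  ultimately show ?case using Suc by argo
qed simp

lemma sum_inverse_square_le:
  assumes "0 < K" and "finite A" and "\<And>z. z \<in> A \<Longrightarrow> K < z"
  shows "(\<Sum>z\<in>A. 1 / (real_of_int z)\<^sup>2) \<le> 1 / real_of_int K"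
proof -
  have tail: "(\<Sum>z\<in>{K<..K + int n}. 1 / (real_of_int z)\<^sup>2) \<le> 1 / real_of_int K - 1 / real_of_int (K + int n)" for n
  proof (induction n)
    case (Suc n)
    define r where "r = real_of_int (K + int n)"
    have r: "0 < r" using assms(1) by (simp add: r_def)
    have "{K<..K + int (Suc n)} = insert (K + int (Suc n)) {K<..K + int n}" by auto
    then have "(\<Sum>z\<in>{K<..K + int (Suc n)}. 1 / (real_of_int z)\<^sup>2) =
        1 / (real_of_int (K + int (Suc n)))\<^sup>2 + (\<Sum>z\<in>{K<..K + int n}. 1 / (real_of_int z)\<^sup>2)"
      by simp
    moreover have "1 / (r + 1)\<^sup>2 \<le> 1 / r - 1 / (r + 1)"
      using r by (simp add: divide_simps power2_eq_square)
    moreover have e: "real_of_int (K + int (Suc n)) = r + 1" by (simp add: r_def)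
    moreover note Suc[folded r_def]
    ultimately show ?case unfolding e by argo
  qed simp
  obtain n where n: "A \<subseteq> {K<..K + int n}"
  proof
    show "A \<subseteq> {K<..K + int (nat (Max (insert K A) - K))}"
      using assms by (auto simp: algebra_simps intro!: Max_ge)
  qed
  have "(\<Sum>z\<in>A. 1 / (real_of_int z)\<^sup>2) \<le> (\<Sum>z\<in>{K<..K + int n}. 1 / (real_of_int z)\<^sup>2)"
    using n by (intro sum_mono2) auto
  also have "\<dots> \<le> 1 / real_of_int K - 1 / real_of_int (K + int n)" by (rule tail)
  also have "\<dots> \<le> 1 / real_of_int K" using assms(1) by simp
  finally show ?thesis .
qed

text \<open>
  With \<open>K = Q - P\<close>, positions within distance \<open>K\<close> of the interval contribute a harmonic sum, of order
  \<open>ln K\<close>, while on each side the positions further away contribute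
  \<open>K\<close> times the tail of \<open>1 / p^2\<close> beyond \<open>K\<close>, which is bounded.
\<close>

lemma column_deviation_total_le:
  assumes c: "even_config c" "odd (P + int t)" "odd (Q + int t)" and PQ: "P < Q" and W: "finite W"
  shows "(\<Sum>y\<in>W. \<bar>column_deviation c t P Q y\<bar>) \<le> 24 + 8 * ln (2 * real_of_int (Q - P) + 1)"
proof -
  define K where "K = Q - P"
  have K: "0 < K" using PQ by (simp add: K_def)
  define A where "A = {y \<in> W. y < P - K}"
  define B where "B = {y \<in> W. Q + K < y}"
  define N where "N = {y \<in> W. P - K \<le> y \<and> y \<le> Q + K}"
  let ?f = "\<lambda>y. \<bar>column_deviation c t P Q y\<bar>"
  have fin: "finite A" "finite B" "finite N" using W by (simp_all add: A_def B_def N_def)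
  have W_split: "W = (A \<union> B) \<union> N" by (auto simp: A_def B_def N_def)
  have "(A \<union> B) \<inter> N = {}" "A \<inter> B = {}" using PQ K by (auto simp: A_def B_def N_def)
  then have split: "sum ?f W = sum ?f A + sum ?f B + sum ?f N"
    unfolding W_split using fin by (simp add: sum.union_disjoint)
  \<comment> \<open>Both outer parts are treated at once: \<open>d\<close> is the distance to the nearer endpoint.\<close>
  have far: "(\<Sum>y\<in>S. 8 * real_of_int (Q - P) / (real_of_int (d y))\<^sup>2) \<le> 8"
    if "finite S" "inj_on d S" "\<And>y. y \<in> S \<Longrightarrow> K < d y" for S and d :: "int \<Rightarrow> int"
  proof -
    have "(\<Sum>y\<in>S. 8 * real_of_int (Q - P) / (real_of_int (d y))\<^sup>2) =
        8 * real_of_int K * (\<Sum>z\<in>d ` S. 1 / (real_of_int z)\<^sup>2)"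
      using that(2) by (simp add: sum.reindex sum_distrib_left K_def)
    also have "\<dots> \<le> 8 * real_of_int K * (1 / real_of_int K)"
      using that K by (intro mult_left_mono sum_inverse_square_le) auto
    also have "\<dots> = 8" using K by simp
    finally show ?thesis .
  qed
  have "sum ?f A \<le> (\<Sum>y\<in>A. 8 * real_of_int (Q - P) / (real_of_int (P - y))\<^sup>2)"
    using PQ K by (intro sum_mono column_deviation_far_left[OF c]) (auto simp: A_def)
  also have "\<dots> \<le> 8" using fin by (intro far) (auto simp: A_def inj_on_def)
  finally have fA: "sum ?f A \<le> 8" .
  have "sum ?f B \<le> (\<Sum>y\<in>B. 8 * real_of_int (Q - P) / (real_of_int (y - Q))\<^sup>2)"
    using PQ K by (intro sum_mono column_deviation_far_right[OF c]) (auto simp: B_def)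
  also have "\<dots> \<le> 8" using fin by (intro far) (auto simp: B_def inj_on_def)
  finally have fB: "sum ?f B \<le> 8" .
  have near: "(\<Sum>y\<in>N. 2 / (\<bar>real_of_int (R - y)\<bar> + 1)) \<le> 4 * (1 + ln (2 * real_of_int K + 1))"
    if "P \<le> R" "R \<le> Q" for R
  proof -
    have "(\<Sum>y\<in>N. 2 / (\<bar>real_of_int (R - y)\<bar> + 1)) = 2 * (\<Sum>z\<in>(\<lambda>y. R - y) ` N. 1 / (\<bar>real_of_int z\<bar> + 1))"
      by (simp add: sum.reindex inj_on_def sum_distrib_left)
    also have "(\<Sum>z\<in>(\<lambda>y. R - y) ` N. 1 / (\<bar>real_of_int z\<bar> + 1))
        \<le> (\<Sum>z\<in>{- int (nat (2 * K))..int (nat (2 * K))}. 1 / (\<bar>real_of_int z\<bar> + 1))"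
      using that K by (intro sum_mono2) (auto simp: N_def K_def)
    also have "\<dots> \<le> 2 * (1 + ln (real (nat (2 * K)) + 1))" by (rule sum_inverse_dist_le)
    also have "real (nat (2 * K)) = 2 * real_of_int K" using K by simp
    finally show ?thesis by simp
  qed
  have "sum ?f N \<le> (\<Sum>y\<in>N. 2 / (\<bar>real_of_int (P - y)\<bar> + 1) + 2 / (\<bar>real_of_int (Q - y)\<bar> + 1))"
    by (intro sum_mono column_deviation_near[OF c])
  also have "\<dots> \<le> 4 * (1 + ln (2 * real_of_int K + 1)) + 4 * (1 + ln (2 * real_of_int K + 1))"
    unfolding sum.distrib using PQ by (intro add_mono near) auto
  finally have "sum ?f N \<le> 8 + 8 * ln (2 * real_of_int K + 1)" by simp
  then show ?thesis using split fA fB by (simp add: K_def)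
qed

text \<open>
  Of the four endpoint terms in the deviation formula, parity kills one at each end; for all
  positions \<open>y\<close> and times at which \<open>y\<close> may be occupied these are the same two.
\<close>

lemma discrepancy_le:
  assumes c: "even_config c" and L: "2 \<le> L" and X: "interval_of_length X L"
  shows "discrepancy c X t \<le> 80 * ln (real L)"
proof -
  obtain a where a: "X = {a..<a + int L}" using X by (auto simp: interval_of_length_def)
  define P where "P = (if even (a + int t) then a - 1 else a)"
  define Q where "Q = (if even (a + int L + int t) then a + int L - 1 else a + int L)"
  have par: "odd (P + int t)" "odd (Q + int t)" by (auto simp: P_def Q_def)
  have PQ: "P < Q" "Q - P \<le> int L + 1" using L by (auto simp: P_def Q_def)
  let ?W = "{a - int t..a + int L + int t}"
  have "imbalance c y s *
      ((walk_prob (a - 1 - y) (t - 1 - s) + walk_prob (a - y) (t - 1 - s)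
        - walk_prob (a + int L - 1 - y) (t - 1 - s) - walk_prob (a + int L - y) (t - 1 - s)) / 2)
    = imbalance c y s * ((walk_prob (P - y) (t - 1 - s) - walk_prob (Q - y) (t - 1 - s)) / 2)"
    if "s < t" for y s
  proof (cases "even (y + int s)")
    case True
    define u where "u = t - 1 - s"
    have u: "int u = int t - 1 - int s" using that by (simp add: u_def)
    have "walk_prob (a - 1 - y) u + walk_prob (a - y) u = walk_prob (P - y) u"
    proof (cases "even (a + int t)")
      case True
      then have "odd (int u + (a - y))" using u \<open>even (y + int s)\<close> by auto
      then have "walk_prob (a - y) u = 0" by (intro walk_prob_eq_0 disjI2)
      then show ?thesis using True by (simp add: P_def)
    next
      case False
      then have "odd (int u + (a - 1 - y))" using u \<open>even (y + int s)\<close> by auto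
      then have "walk_prob (a - 1 - y) u = 0" by (intro walk_prob_eq_0 disjI2)
      then show ?thesis using False by (simp add: P_def)
    qed
    moreover have "walk_prob (a + int L - 1 - y) u + walk_prob (a + int L - y) u = walk_prob (Q - y) u"
    proof (cases "even (a + int L + int t)")
      case True
      then have "odd (int u + (a + int L - y))" using u \<open>even (y + int s)\<close> by auto
      then have "walk_prob (a + int L - y) u = 0" by (intro walk_prob_eq_0 disjI2)
      then show ?thesis using True by (simp add: Q_def)
    next
      case False
      then have "odd (int u + (a + int L - 1 - y))" using u \<open>even (y + int s)\<close> by auto
      then have "walk_prob (a + int L - 1 - y) u = 0" by (intro walk_prob_eq_0 disjI2)
      then show ?thesis using False by (simp add: Q_def)
    qed
    ultimately have "walk_prob (a - 1 - y) u + walk_prob (a - y) u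
        - walk_prob (a + int L - 1 - y) u - walk_prob (a + int L - y) u =
        walk_prob (P - y) u - walk_prob (Q - y) u" by linarith
    then show ?thesis unfolding u_def [symmetric] by (simp only:)
  qed (simp add: imbalance_eq_0_of_odd[OF c])
  then have "(\<Sum>x\<in>X. real (chips c x t)) - (\<Sum>x\<in>X. expected_chips c x t) =
      (\<Sum>y\<in>?W. column_deviation c t P Q y)"
    using c unfolding a column_deviation_def
    by (subst interval_discrepancy) (auto simp: even_config_def intro!: sum.cong)
  then have "discrepancy c X t = \<bar>\<Sum>y\<in>?W. column_deviation c t P Q y\<bar>"
    by (simp add: discrepancy_def)
  also have "\<dots> \<le> (\<Sum>y\<in>?W. \<bar>column_deviation c t P Q y\<bar>)" by (rule sum_abs)
  also have "\<dots> \<le> 24 + 8 * ln (2 * real_of_int (Q - P) + 1)"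
    using c par PQ(1) by (intro column_deviation_total_le) auto
  also have "\<dots> \<le> 24 + 8 * (4 * ln (real L))"
  proof -
    have "real_of_int (Q - P) \<le> real_of_int (int L + 1)" using PQ(2) by (simp only: of_int_le_iff)
    then have "2 * real_of_int (Q - P) + 1 \<le> 2 * real L + 3" by simp
    also have "\<dots> \<le> real L ^ 4"
    proof -
      have "2 ^ 3 \<le> real L ^ 3" using L by (intro power_mono) auto
      then have "real L * 8 \<le> real L * real L ^ 3" by (intro mult_left_mono) auto
      moreover have "real L * real L ^ 3 = real L ^ 4" by (simp add: numeral_eq_Suc)
      moreover have "2 \<le> real L" using L by simp
      ultimately show ?thesis by linarith
    qed
    finally have "2 * real_of_int (Q - P) + 1 \<le> real L ^ 4" .
    moreover have "0 < 2 * real_of_int (Q - P) + 1" using PQ(1) by simp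
    ultimately have "ln (2 * real_of_int (Q - P) + 1) \<le> ln (real L ^ 4)"
      using order_less_le_trans by (subst ln_le_cancel_iff) blast+
    also have "\<dots> = 4 * ln (real L)" using L by (simp add: ln_realpow)
    finally show ?thesis by simp
  qed
  also have "\<dots> \<le> 80 * ln (real L)"
  proof -
    have "ln (1 / 2 :: real) \<le> 1 / 2 - 1" by (rule ln_le_minus_one) simp
    then have "1 / 2 \<le> ln (2::real)" by (simp add: ln_div)
    also have "\<dots> \<le> ln (real L)" using L by simp
    finally show ?thesis by simp
  qed
  finally show ?thesis .
qed

section \<open>Forcing parities\<close>

text \<open>
  The random walk without its normalising factor \<open>2 ^ t\<close>.
\<close>

fun spread :: "(int \<Rightarrow> nat) \<Rightarrow> nat \<Rightarrow> int \<Rightarrow> nat" where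
  "spread e 0 x = e x"
| "spread e (Suc t) x = spread e t (x - 1) + spread e t (x + 1)"

text \<open>
  A pile whose size is a multiple of \<open>2 ^ T\<close> splits evenly \<open>T\<close> times, so up to time
  \<open>T\<close> it runs as an exact random walk on top of the old configuration, without affecting arrows or,
  before time \<open>T\<close>, parities.
\<close>

lemma chips_arr_add_pow2:
  assumes A: "\<forall>x. A x \<in> {-1, 1}" and "t \<le> T"
  shows "chips (\<lambda>x. f x + 2 ^ T * e x, A) x t = chips (f, A) x t + 2 ^ (T - t) * spread e t x"
    and "arr (\<lambda>x. f x + 2 ^ T * e x, A) x t = arr (f, A) x t"
  using assms(2)
proof (induction t arbitrary: x)
  case 0
  { case 1 then show ?case by simp next case 2 then show ?case by simp }
next
  case (Suc t)
  let ?c = "(\<lambda>x. f x + 2 ^ T * e x, A)"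
  have c: "is_config ?c" "is_config (f, A)" using A by (auto simp: is_config_def)
  { case 1
    have r: "T - t = Suc (T - Suc t)" using 1 by simp
    have chips: "chips ?c z t = chips (f, A) z t + 2 * (2 ^ (T - Suc t) * spread e t z)" for z
      using Suc.IH(1)[of z] 1 unfolding r by simp
    have mod: "chips ?c z t mod 2 = chips (f, A) z t mod 2" for z unfolding chips by simp
    have arr: "arr ?c z t = arr (f, A) z t" for z using Suc.IH(2) 1 by simp
    have "real (chips ?c x (Suc t)) = real (chips (f, A) x (Suc t) + 2 ^ (T - Suc t) * spread e (Suc t) x)"
      unfolding chips_Suc[OF c(1)] mod arr of_nat_add chips_Suc[OF c(2)] chips
      by (simp add: algebra_simps)
    then show ?case by (simp only: of_nat_eq_iff)
  next
    case 2
    have r: "T - t = Suc (T - Suc t)" using 2 by simp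
    have "even (chips ?c x t) \<longleftrightarrow> even (chips (f, A) x t)"
      using Suc.IH(1)[of x] 2 unfolding r by simp
    then have "(-1 :: int) ^ chips ?c x t = (-1) ^ chips (f, A) x t"
      by (simp add: minus_one_power_iff)
    then show ?case using Suc.IH(2)[of x] 2 by (simp add: arr_Suc) }
qed

text \<open>
  Modulo 2 the equation \<open>e (x - 1) + e (x + 1) = b x\<close> is solved by starting from
  \<open>0\<close> near the origin and summing \<open>b\<close> outwards in both directions over every other position.
\<close>

lemma spread_step_surj_mod2:
  fixes b :: "int \<Rightarrow> nat"
  assumes b: "\<And>x. even (x + p) \<Longrightarrow> b x = 0"
  obtains e :: "int \<Rightarrow> nat" where "\<And>x. odd (x + p) \<Longrightarrow> e x = 0"
    and "\<And>x. even (e (x - 1) + e (x + 1)) \<longleftrightarrow> even (b x)"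
proof
  define S where "S z = {i \<in> {0..<z} \<union> {z<..<0}. odd (i + z)}" for z :: int
  define e where "e z = sum b (S z)" for z
  have fin: "finite (S z)" for z
    by (rule finite_subset[of _ "{0..<z} \<union> {z<..<0}"]) (auto simp: S_def)
  show "e x = 0" if "odd (x + p)" for x
  proof -
    have "b i = 0" if "odd (i + x)" for i
    proof (rule b)
      have "i + p = (i + x) + (x + p) - 2 * x" by simp
      then show "even (i + p)" using that \<open>odd (x + p)\<close> by simp
    qed
    then show ?thesis by (auto simp: e_def S_def)
  qed
  show "even (e (x - 1) + e (x + 1)) \<longleftrightarrow> even (b x)" for x
  proof (cases "0 \<le> x")
    case True
    have "S (x + 1) = insert x (S (x - 1))"
    proof -
      have "i = x \<or> i < x - 1" if "i < x + 1" "odd (i + (x + 1))" for i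
        using that by (cases "i = x - 1") auto
      then show ?thesis using True by (auto simp: S_def)
    qed
    moreover have "x \<notin> S (x - 1)" using True by (auto simp: S_def)
    ultimately have "e (x + 1) = b x + e (x - 1)" using fin by (simp add: e_def)
    then show ?thesis by auto
  next
    case False
    have "S (x - 1) = insert x (S (x + 1))"
    proof -
      have "i = x \<or> x + 1 < i" if "x - 1 < i" "odd (i + (x - 1))" for i
        using that by (cases "i = x + 1") auto
      then show ?thesis using False by (auto simp: S_def)
    qed
    moreover have "x \<notin> S (x + 1)" using False by (auto simp: S_def)
    ultimately have "e (x - 1) = b x + e (x + 1)" using fin by (simp add: e_def)
    then show ?thesis by auto
  qed
qed

lemma spread_surj_mod2:
  fixes b :: "int \<Rightarrow> nat"
  assumes "\<And>x. odd (x + int T) \<Longrightarrow> b x = 0"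
  shows "\<exists>e :: int \<Rightarrow> nat. (\<forall>x. odd x \<longrightarrow> e x = 0) \<and> (\<forall>x. even (spread e T x) \<longleftrightarrow> even (b x))"
  using assms
proof (induction T arbitrary: b)
  case 0
  then show ?case by (intro exI[of _ b]) auto
next
  case (Suc T)
  obtain d :: "int \<Rightarrow> nat" where d: "\<And>x. odd (x + int T) \<Longrightarrow> d x = 0"
    "\<And>x. even (d (x - 1) + d (x + 1)) \<longleftrightarrow> even (b x)"
    using spread_step_surj_mod2[of "int T" b] Suc.prems by auto
  obtain e :: "int \<Rightarrow> nat" where e: "\<forall>x. odd x \<longrightarrow> e x = 0" "\<forall>x. even (spread e T x) \<longleftrightarrow> even (d x)"
    using Suc.IH[of d] d(1) by blast
  have "even (spread e (Suc T) x) \<longleftrightarrow> even (b x)" for x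
    using e(2) d(2)[of x] by simp
  then show ?case using e(1) by blast
qed

text \<open>
  All parities can be prescribed for finitely many time steps. Once they are right before time
  \<open>T\<close>, piles of multiples of \<open>2 ^ T\<close> leave them unchanged and can correct every parity at time
  \<open>T\<close>, because spreading for \<open>T\<close> steps is surjective modulo 2.
\<close>

lemma parity_forcing:
  fixes \<rho> :: "int \<Rightarrow> nat \<Rightarrow> bool"
  assumes A: "\<forall>x. A x \<in> {-1, 1}"
  shows "\<exists>f. even_config (f, A) \<and> (\<forall>s<T. \<forall>x. even (x + int s) \<longrightarrow> odd (chips (f, A) x s) = \<rho> x s)"
proof (induction T)
  case 0
  have "even_config (\<lambda>_. 0, A)" using A by (simp add: even_config_def is_config_def)
  then show ?case by auto
next
  case (Suc T)
  then obtain f where f: "even_config (f, A)"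
    and \<rho>: "\<And>s x. s < T \<Longrightarrow> even (x + int s) \<Longrightarrow> odd (chips (f, A) x s) = \<rho> x s" by blast
  define b :: "int \<Rightarrow> nat" where
    "b x = (if even (x + int T) \<and> odd (chips (f, A) x T) \<noteq> \<rho> x T then 1 else 0)" for x
  obtain e :: "int \<Rightarrow> nat" where e: "\<forall>x. odd x \<longrightarrow> e x = 0" "\<forall>x. even (spread e T x) \<longleftrightarrow> even (b x)"
    using spread_surj_mod2[of T b] by (auto simp: b_def)
  let ?f = "\<lambda>x. f x + 2 ^ T * e x"
  have chips: "chips (?f, A) x s = chips (f, A) x s + 2 ^ (T - s) * spread e s x" if "s \<le> T" for x s
    using chips_arr_add_pow2(1)[OF A that] .
  have "odd (chips (?f, A) x s) = \<rho> x s" if "s < Suc T" "even (x + int s)" for x s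
  proof (cases "s < T")
    case True
    then show ?thesis using chips[of s x] \<rho>[OF True that(2)] by simp
  next
    case False
    then have s: "s = T" using that by simp
    show ?thesis using chips[of T x] e(2) that(2) unfolding s by (auto simp: b_def)
  qed
  moreover have "even_config (?f, A)" using f e(1) by (simp add: even_config_def is_config_def)
  ultimately show ?case by blast
qed

section \<open>The lower bound\<close>

text \<open>
  A linearised Gaussian bound: moving \<open>j\<close> away from the centre costs at most the factor
  \<open>1 - j^2 / n\<close>.
\<close>

lemma binomial_near_centre:
  "j \<le> n \<Longrightarrow> (real n - (real j)\<^sup>2) * real (2 * n choose n) \<le> real n * real (2 * n choose (n + j))"
proof (induction j)
  case (Suc j)
  let ?c = "real (2 * n choose n)" and ?b = "\<lambda>j. real (2 * n choose (n + j))"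
  have "real (Suc (n + j) * (2 * n choose Suc (n + j))) = real ((2 * n - (n + j)) * (2 * n choose (n + j)))"
    by (simp only: Suc_times_binomial_Suc)
  moreover have "real (2 * n - (n + j)) = real n - real j" using Suc.prems by (simp add: of_nat_diff)
  ultimately have rec: "(real n + real j + 1) * ?b (Suc j) = (real n - real j) * ?b j"
    unfolding of_nat_mult by (simp add: add_ac)
  have "(real n + real j + 1) * ((real n - (real (Suc j))\<^sup>2) * ?c) \<le> (real n - real j) * (real n - (real j)\<^sup>2) * ?c"
  proof -
    have "(real n - real j) * (real n - (real j)\<^sup>2) - (real n + real j + 1) * (real n - (real (Suc j))\<^sup>2)
        = real j ^ 3 + (real j + 1) ^ 3"
      by (simp add: power2_eq_square power3_eq_cube algebra_simps)
    moreover have "0 \<le> real j ^ 3 + (real j + 1) ^ 3" by simp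
    ultimately have "(real n + real j + 1) * (real n - (real (Suc j))\<^sup>2) \<le> (real n - real j) * (real n - (real j)\<^sup>2)"
      by linarith
    then show ?thesis unfolding mult.assoc [symmetric] by (intro mult_right_mono) auto
  qed
  also have "\<dots> = (real n - real j) * ((real n - (real j)\<^sup>2) * ?c)" by simp
  also have "\<dots> \<le> (real n - real j) * (real n * ?b j)"
    using Suc by (intro mult_left_mono) auto
  also have "\<dots> = (real n + real j + 1) * (real n * ?b (Suc j))" using rec by (simp only: mult.left_commute)
  finally show ?case by (rule mult_left_le_imp_le) simp
qed simp

text \<open>
  At time \<open>(2 * j)^2\<close> the walk has not yet decayed noticeably at distance \<open>2 * j\<close>. The lemma
  above applies with \<open>n = 2 * j^2\<close>, where its factor is \<open>1 / 2\<close>.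
\<close>

lemma walk_prob_sqrt_ge: "1 / (6 * (real j + 1)) \<le> walk_prob (2 * int j) (4 * j\<^sup>2)"
proof (cases "j = 0")
  case False
  define n where "n = 2 * j\<^sup>2"
  have n: "0 < n" "j \<le> n" "4 * j\<^sup>2 = 2 * n" "real n = 2 * (real j)\<^sup>2"
    using False by (auto simp: n_def power2_eq_square)
  have "2 * int j = 2 * int (n + j) - int (2 * n)" by simp
  then have p: "walk_prob (2 * int j) (4 * j\<^sup>2) = real (2 * n choose (n + j)) / 2 ^ (2 * n)"
    by (simp only: n(3) walk_prob_binomial)
  have "(real n / 2) * real (2 * n choose n) \<le> real n * real (2 * n choose (n + j))"
    using binomial_near_centre[OF n(2)] by (simp add: n(4))
  then have "real n * (real (2 * n choose n) / 2) \<le> real n * real (2 * n choose (n + j))" by simp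
  then have half: "real (2 * n choose n) / 2 \<le> real (2 * n choose (n + j))"
    using n(1) by simp
  have "1 / (3 * (real j + 1)) \<le> walk_density 0 n"
  proof (rule power2_le_imp_le)
    have "4 * real n + 1 \<le> (3 * (real j + 1))\<^sup>2" by (simp add: n(4) power2_eq_square algebra_simps)
    then have "(walk_density 0 n)\<^sup>2 * (4 * real n + 1) \<le> (walk_density 0 n)\<^sup>2 * (3 * (real j + 1))\<^sup>2"
      by (intro mult_left_mono) auto
    with central_density_bounds(2)[of n] have "1 \<le> (walk_density 0 n)\<^sup>2 * (3 * (real j + 1))\<^sup>2" by linarith
    then show "(1 / (3 * (real j + 1)))\<^sup>2 \<le> (walk_density 0 n)\<^sup>2"
      by (simp add: power_divide pos_divide_le_eq)
  qed (rule walk_density_nonneg)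
  then have "1 / (6 * (real j + 1)) \<le> real (2 * n choose n) / 2 / 2 ^ (2 * n)"
    by (simp add: walk_density_def field_simps)
  also have "\<dots> \<le> walk_prob (2 * int j) (4 * j\<^sup>2)"
    unfolding p using half by (intro divide_right_mono) auto
  finally show ?thesis .
qed (simp add: walk_prob_0)

lemma ln_le_harmonic: "ln (real J + 2) \<le> (\<Sum>j\<le>J. 1 / (real j + 1))"
proof (induction J)
  case 0
  show ?case using ln_le_minus_one[of 2] by simp
next
  case (Suc J)
  have "ln ((real J + 3) / (real J + 2)) \<le> (real J + 3) / (real J + 2) - 1"
    by (intro ln_le_minus_one) simp
  moreover have "(real J + 3) / (real J + 2) - 1 = 1 / (real J + 2)" by (simp add: field_simps)
  ultimately have "ln (real J + 3) - ln (real J + 2) \<le> 1 / (real J + 2)" by (simp add: ln_div)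
  moreover have "real (Suc J) + 2 = real J + 3" "real (Suc J) + 1 = real J + 2" by simp_all
  ultimately show ?case using Suc by (simp only: sum.atMost_Suc)
qed

lemma arr_eq_initial:
  "(\<And>s. s < t \<Longrightarrow> even (chips c y s)) \<Longrightarrow> arr c y t = snd c y"
  by (induction t) (auto simp: arr_Suc)

lemma floor_sqrt_quarter:
  obtains J :: nat where "4 * J\<^sup>2 \<le> L" "L < 4 * (J + 1)\<^sup>2"
proof -
  have "\<exists>J. 4 * J\<^sup>2 \<le> L \<and> L < 4 * (J + 1)\<^sup>2"
  proof (induction L)
    case (Suc L)
    then obtain J where J: "4 * J\<^sup>2 \<le> L" "L < 4 * (J + 1)\<^sup>2" by blast
    show ?case
    proof (cases "Suc L < 4 * (J + 1)\<^sup>2")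
      case True
      then show ?thesis using J by (intro exI[of _ J]) simp
    next
      case False
      then have "Suc L = 4 * (J + 1)\<^sup>2" using J by simp
      then show ?thesis by (intro exI[of _ "J + 1"]) (simp add: power2_eq_square)
    qed
  qed (intro exI[of _ 0], simp)
  then show ?thesis using that by blast
qed

text \<open>
  All arrows start to the right, and parities are forced so that each position \<open>-2 * j\<close> with
  \<open>j \<le> J\<close> has an odd number of chips exactly once, namely when \<open>4 * j^2\<close> steps remain after
  its leftover chip has moved. All contributions are then positive. Since \<open>4 * J^2 \<le> L\<close>, the influence of
  these chips does not extend to the far end of the interval, so position \<open>-2 * j\<close> contributes half a walk
  probability of order \<open>1 / (j + 1)\<close> without loss, and \<open>J\<close> of order \<open>sqrt L\<close> still gives a harmonic sum of order \<open>ln L\<close>.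
\<close>

lemma discrepancy_ge:
  assumes L: "2 \<le> L"
  shows "\<exists>c t. even_config c \<and> 1 / 48 * ln (real L) \<le> discrepancy c {0..<int L} t"
proof -
  obtain J where J: "4 * J\<^sup>2 \<le> L" "L < 4 * (J + 1)\<^sup>2" by (rule floor_sqrt_quarter)
  define T where "T = 4 * J\<^sup>2"
  \<comment> \<open>The deviation is measured at time \<open>Suc T\<close>, so a chip leaving at time \<open>s\<close> has \<open>T - s\<close> steps left.\<close>
  define \<rho> where "\<rho> y s \<longleftrightarrow> (\<exists>j\<le>J. y = - 2 * int j \<and> s + 4 * j\<^sup>2 = T)" for y s
  obtain f where c: "even_config (f, \<lambda>_. 1)"
    and odd_iff: "\<And>s y. s < Suc T \<Longrightarrow> even (y + int s) \<Longrightarrow> odd (chips (f, \<lambda>_. 1) y s) = \<rho> y s"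
    using parity_forcing[of "\<lambda>_. 1" "Suc T" \<rho>] by auto
  define c where "c = (f, \<lambda>_ :: int. 1 :: int)"
  note c = c[folded c_def] and odd_iff = odd_iff[folded c_def]
  have odd_chips: "odd (chips c y s) \<longleftrightarrow> \<rho> y s" if "s \<le> T" for y s
  proof (cases "even (y + int s)")
    case False
    have "\<not> \<rho> y s"
    proof
      assume "\<rho> y s"
      then obtain j where j: "y = - 2 * int j" "s + 4 * j\<^sup>2 = T" by (auto simp: \<rho>_def)
      then have "even (s + 4 * j\<^sup>2)" by (simp only: T_def) simp
      then show False using False j(1) by simp
    qed
    then show ?thesis using chips_eq_0_of_odd[OF c False] by simp
  qed (use odd_iff that in simp)
  have imb: "imbalance c y s = (if \<rho> y s then 1 else 0)" if "s \<le> T" for y s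
  proof (cases "\<rho> y s")
    case True
    have "even (chips c y s')" if "s' < s" for s'
    proof -
      have "\<not> \<rho> y s'" using True that by (auto simp: \<rho>_def)
      then show ?thesis using odd_chips[of s' y] that \<open>s \<le> T\<close> by simp
    qed
    then have "arr c y s = 1" by (subst arr_eq_initial) (auto simp: c_def)
    moreover have "chips c y s mod 2 = 1" using odd_chips[OF that, of y] True by presburger
    ultimately show ?thesis using True by (simp add: imbalance_def)
  next
    case False
    then show ?thesis using odd_chips[OF that, of y] by (simp add: imbalance_def)
  qed
  define g where "g y u = (walk_prob (- 1 - y) u + walk_prob (- y) u
      - walk_prob (int L - 1 - y) u - walk_prob (int L - y) u) / 2" for y u
  let ?W = "{- int (Suc T)..int L + int (Suc T)}"
  define S where "S y = (\<Sum>s<Suc T. imbalance c y s * g y (T - s))" for y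
  have diff: "(\<Sum>x\<in>{0..<int L}. real (chips c x (Suc T))) - (\<Sum>x\<in>{0..<int L}. expected_chips c x (Suc T))
      = (\<Sum>y\<in>?W. S y)"
    using interval_discrepancy[where c = c and a = 0 and L = L and t = "Suc T"] c
    by (simp add: even_config_def S_def g_def del: sum.lessThan_Suc)
  have S_eq: "S (- 2 * int j) = g (- 2 * int j) (4 * j\<^sup>2)" if "j \<le> J" for j
  proof -
    have le: "4 * j\<^sup>2 \<le> T" using that by (simp add: T_def power_mono)
    have "S (- 2 * int j) = (\<Sum>s<Suc T. if s = T - 4 * j\<^sup>2 then g (- 2 * int j) (T - s) else 0)"
      unfolding S_def using that le by (intro sum.cong) (auto simp: imb \<rho>_def)
    also have "\<dots> = g (- 2 * int j) (4 * j\<^sup>2)" using le by (simp del: sum.lessThan_Suc)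
    finally show ?thesis .
  qed
  have S_0: "S y = 0" if "y \<notin> (\<lambda>j. - 2 * int j) ` {..J}" for y
    unfolding S_def using that by (intro sum.neutral) (auto simp: imb \<rho>_def)
  have J2T: "2 * j \<le> Suc T" if "j \<le> J" for j
  proof -
    have "j \<le> J * J" using that le_square order_trans by blast
    then show ?thesis by (simp add: T_def power2_eq_square)
  qed
  have "(\<lambda>j. - 2 * int j) ` {..J} \<subseteq> ?W"
  proof
    fix y assume "y \<in> (\<lambda>j. - 2 * int j) ` {..J}"
    then obtain j where "j \<le> J" "y = - 2 * int j" by auto
    then show "y \<in> ?W" using J2T[of j] by auto
  qed
  then have "(\<Sum>y\<in>?W. S y) = (\<Sum>y\<in>(\<lambda>j. - 2 * int j) ` {..J}. S y)"
    using S_0 by (intro sum.mono_neutral_right) auto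
  also have "\<dots> = (\<Sum>j\<le>J. g (- 2 * int j) (4 * j\<^sup>2))"
    using S_eq by (subst sum.reindex) (auto simp: inj_on_def)
  also have "\<dots> \<ge> (\<Sum>j\<le>J. 1 / 12 * (1 / (real j + 1)))"
  proof (rule sum_mono)
    fix j assume "j \<in> {..J}"
    then have "4 * j\<^sup>2 \<le> 4 * J\<^sup>2" by (simp add: power_mono)
    then have "int (4 * j\<^sup>2) \<le> int L" using J(1) by (simp only: of_nat_le_iff)
    then have far: "int (4 * j\<^sup>2) < int L - 1 + 2 * int j" using L by (cases "j = 0") auto
    have "walk_prob (int L - 1 - (- 2 * int j)) (4 * j\<^sup>2) = 0"
      "walk_prob (int L - (- 2 * int j)) (4 * j\<^sup>2) = 0"
      using far by (auto intro!: walk_prob_eq_0)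
    moreover have "walk_prob (- 1 - (- 2 * int j)) (4 * j\<^sup>2) = 0" by (rule walk_prob_eq_0) simp
    ultimately have g: "g (- 2 * int j) (4 * j\<^sup>2) = walk_prob (2 * int j) (4 * j\<^sup>2) / 2"
      unfolding g_def by simp
    have "1 / 12 * (1 / r) = 1 / (6 * r) / 2" for r :: real by simp
    then have "1 / 12 * (1 / (real j + 1)) = 1 / (6 * (real j + 1)) / 2" .
    also have "\<dots> \<le> g (- 2 * int j) (4 * j\<^sup>2)"
      unfolding g using walk_prob_sqrt_ge[of j] by (intro divide_right_mono) auto
    finally show "1 / 12 * (1 / (real j + 1)) \<le> g (- 2 * int j) (4 * j\<^sup>2)" .
  qed
  also have "(\<Sum>j\<le>J. 1 / 12 * (1 / (real j + 1))) = 1 / 12 * (\<Sum>j\<le>J. 1 / (real j + 1))"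
    by (simp only: sum_distrib_left)
  finally have sum: "1 / 12 * (\<Sum>j\<le>J. 1 / (real j + 1)) \<le> (\<Sum>y\<in>?W. S y)" .
  have "L \<le> (J + 2) ^ 4"
  proof -
    have "2 * (J + 1) \<le> (J + 2)\<^sup>2" by (simp add: power2_eq_square)
    then have "(2 * (J + 1))\<^sup>2 \<le> ((J + 2)\<^sup>2)\<^sup>2" by (rule power_mono) simp
    moreover have "(2 * (J + 1))\<^sup>2 = 4 * (J + 1)\<^sup>2" by (simp add: power2_eq_square)
    moreover have "((J + 2)\<^sup>2)\<^sup>2 = (J + 2) ^ 4" by (simp flip: power_mult)
    ultimately show ?thesis using J(2) by linarith
  qed
  then have "real L \<le> real ((J + 2) ^ 4)" by (simp only: of_nat_le_iff)
  then have "ln (real L) \<le> ln (real ((J + 2) ^ 4))" using L by (subst ln_le_cancel_iff) auto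
  also have "\<dots> = 4 * ln (real J + 2)" by (simp add: ln_realpow)
  finally have "1 / 48 * ln (real L) \<le> 1 / 12 * (\<Sum>j\<le>J. 1 / (real j + 1))"
    using ln_le_harmonic[of J] by linarith
  then have "1 / 48 * ln (real L) \<le> discrepancy c {0..<int L} (Suc T)"
    using sum diff unfolding discrepancy_def of_nat_sum by linarith
  then show ?thesis using c by blast
qed

theorem theorem7:
  shows "\<exists>C c :: real. C > 0 \<and> c > 0 \<and>
    (\<forall>(L :: nat) (I :: config) (t :: nat) (X :: int set).
        L \<ge> 2 \<longrightarrow> even_config I \<longrightarrow> interval_of_length X L \<longrightarrow>
        discrepancy I X t \<le> C * ln (real L)) \<and>
    (\<forall>L :: nat. L > 0 \<longrightarrow>
        (\<exists>(I :: config) (t :: nat) (X :: int set).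
           even_config I \<and> interval_of_length X L \<and>
           discrepancy I X t \<ge> c * ln (real L)))"
proof (rule exI[of _ 80], rule exI[of _ "1 / 48"], intro conjI allI impI)
  show "discrepancy I X t \<le> 80 * ln (real L)"
    if "2 \<le> L" "even_config I" "interval_of_length X L" for L I t X
    using discrepancy_le that by blast
  show "\<exists>I t X. even_config I \<and> interval_of_length X L \<and> 1 / 48 * ln (real L) \<le> discrepancy I X t"
    if "0 < L" for L :: nat
  proof -
    have X: "interval_of_length {0..<int L} L" by (auto simp: interval_of_length_def intro: exI[of _ 0])
    show ?thesis
    proof (cases "L = 1")
      case True
      have "even_config (\<lambda>_. 0, \<lambda>_. 1)" by (simp add: even_config_def is_config_def)
      moreover have "1 / 48 * ln (real L) \<le> discrepancy (\<lambda>_. 0, \<lambda>_. 1) {0..<int L} 0"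
        using True by (simp add: discrepancy_def)
      ultimately show ?thesis using X by blast
    next
      case False
      with that have "2 \<le> L" by linarith
      then obtain c t where "even_config c" "1 / 48 * ln (real L) \<le> discrepancy c {0..<int L} t"
        using discrepancy_ge by blast
      then show ?thesis using X by blast
    qed
  qed
qed auto

end
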